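(* Let $n\ge 1$. A closed $n$-manifold $M$ is an $n$-sphere if and only if there is a point $v\in M$ such that $M-v$ is a contractible space.
   Context: A digital space is a simple undirected graph with a finite or countable set of points (vertices). Subspaces are induced subgraphs; $H\subseteq G$ ("$H$ belongs to $G$") means $H$ is an induced subgraph of $G$. The rim $O(v)$ of a point $v$ is the subspace induced on the neighbors of $v$ (not containing $v$). $G-v$ is $G$ with the point $v$ deleted. Contractible graphs and contractible transformations: the one-point graph is contractible; the contractible transformations of a graph are (1) deleting a point $v$ with $O(v)$ contractible, (2) gluing a new point $v$ whose rim $O(v)$ is a contractible induced subgraph, (3) deleting an edge $(uv)$ with $O(u)\cap O(v)$ contractible, (4) adding an edge between non-adjacent points $u,v$ with $O(u)\cap O(v)$ contractible. A graph is contractible if it can be converted to a single point by a finite sequence of contractible transformations. Disks, spheres and manifolds are defined recursively. A 0-disk is a single point; a 0-sphere is the graph $S^0(a,b)$ with two non-adjacent points $a,b$. A 1-sphere is a finite connected graph in which the rim of each point is a 0-sphere. A 1-disk is a graph $S^1-v$ with $S^1$ a 1-sphere, $v\in S^1$. For $n\ge 1$: a closed $n$-manifold is a connected digital space in which the rim of every point is an $(n-1)$-sphere. An $n$-manifold with boundary is a connected space $N$ such that $N=M-v$ (up to isomorphism) for a closed $n$-manifold $M$ and a point $v\in M$; its boundary is $\partial N=O(v)$ and its interior is $\mathrm{Int}N=N-\partial N$. An $n$-disk is an $n$-manifold with boundary that is a contractible graph. For $n\ge 2$, an $n$-sphere is a graph $D\#C$ obtained from two $n$-disks $D,C$ with isomorphic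 boundaries by identifying each point of $\partial D$ with its counterpart in $\partial C$ under an isomorphism. *)

theory Defs
  imports Main "HOL-Library.Countable_Set" "HOL-Library.Infinite_Typeclass"
begin

(* An undirected edge between x and y is represented by both pairs (x, y) and (y, x). *)
datatype 'a graph = Graph (verts: "'a set") (edges: "('a \<times> 'a) set")

definition digital_space :: "'a graph \<Rightarrow> bool" where
  "digital_space G \<longleftrightarrow> countable (verts G) \<and> edges G \<subseteq> verts G \<times> verts G
     \<and> sym (edges G) \<and> irrefl (edges G)"

definition induced :: "'a graph \<Rightarrow> 'a set \<Rightarrow> 'a graph" where
  "induced G W = Graph (verts G \<inter> W) (edges G \<inter> W \<times> W)"

definition nbrs :: "'a graph \<Rightarrow> 'a \<Rightarrow> 'a set" where
  "nbrs G v = edges G `` {v}"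

definition rim :: "'a graph \<Rightarrow> 'a \<Rightarrow> 'a graph" where
  "rim G v = induced G (nbrs G v)"

definition common_rim :: "'a graph \<Rightarrow> 'a \<Rightarrow> 'a \<Rightarrow> 'a graph" where
  "common_rim G u v = induced G (nbrs G u \<inter> nbrs G v)"

definition del_point :: "'a graph \<Rightarrow> 'a \<Rightarrow> 'a graph" where
  "del_point G v = induced G (verts G - {v})"

definition glue_point :: "'a graph \<Rightarrow> 'a \<Rightarrow> 'a set \<Rightarrow> 'a graph" where
  "glue_point G v A = Graph (insert v (verts G)) (edges G \<union> {v} \<times> A \<union> A \<times> {v})"

definition del_edge :: "'a graph \<Rightarrow> 'a \<Rightarrow> 'a \<Rightarrow> 'a graph" where
  "del_edge G u v = Graph (verts G) (edges G - {(u, v), (v, u)})"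

definition add_edge :: "'a graph \<Rightarrow> 'a \<Rightarrow> 'a \<Rightarrow> 'a graph" where
  "add_edge G u v = Graph (verts G) (edges G \<union> {(u, v), (v, u)})"

(* Contractible graphs and contractible transformations refer to each other, so they are
   the least pair of predicates closed under the rules below.  New points are taken
   from the type 'a, so this is the intended notion only for infinite 'a: there every
   finite graph has fresh points available (and only finite graphs can be reduced to a
   point in finitely many steps). *)
inductive contractible_graph :: "'a graph \<Rightarrow> bool"
  and contractible_trans :: "'a graph \<Rightarrow> 'a graph \<Rightarrow> bool" where
  one_point: "contractible_graph (Graph {v} {})"
| step: "contractible_trans G H \<Longrightarrow> contractible_graph H \<Longrightarrow> contractible_graph G"
| point_deletion:
    "\<lbrakk>digital_space G; v \<in> verts G; contractible_graph (rim G v)\<rbrakk>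
     \<Longrightarrow> contractible_trans G (del_point G v)"
| point_gluing:
    "\<lbrakk>digital_space G; v \<notin> verts G; A \<subseteq> verts G; contractible_graph (induced G A)\<rbrakk>
     \<Longrightarrow> contractible_trans G (glue_point G v A)"
| edge_deletion:
    "\<lbrakk>digital_space G; (u, v) \<in> edges G; contractible_graph (common_rim G u v)\<rbrakk>
     \<Longrightarrow> contractible_trans G (del_edge G u v)"
| edge_addition:
    "\<lbrakk>digital_space G; u \<in> verts G; v \<in> verts G; u \<noteq> v; (u, v) \<notin> edges G;
      contractible_graph (common_rim G u v)\<rbrakk>
     \<Longrightarrow> contractible_trans G (add_edge G u v)"

definition connected_graph :: "'a graph \<Rightarrow> bool" where
  "connected_graph G \<longleftrightarrow> verts G \<noteq> {} \<and> (\<forall>u\<in>verts G. \<forall>v\<in>verts G. (u, v) \<in> (edges G)\<^sup>*)"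

definition graph_iso :: "('a \<Rightarrow> 'b) \<Rightarrow> 'a graph \<Rightarrow> 'b graph \<Rightarrow> bool" where
  "graph_iso f G H \<longleftrightarrow> bij_betw f (verts G) (verts H)
     \<and> (\<forall>x\<in>verts G. \<forall>y\<in>verts G. (x, y) \<in> edges G \<longleftrightarrow> (f x, f y) \<in> edges H)"

definition zero_sphere :: "'a graph \<Rightarrow> bool" where
  "zero_sphere G \<longleftrightarrow> (\<exists>a b. a \<noteq> b \<and> G = Graph {a, b} {})"

definition one_sphere :: "'a graph \<Rightarrow> bool" where
  "one_sphere G \<longleftrightarrow> digital_space G \<and> finite (verts G) \<and> connected_graph G
     \<and> (\<forall>v\<in>verts G. zero_sphere (rim G v))"

(* The next three definitions are one level of the recursion on the dimension n;
   the parameter S stands for "being an (n-1)-sphere". *)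
definition closed_manifold_over :: "('a graph \<Rightarrow> bool) \<Rightarrow> 'a graph \<Rightarrow> bool" where
  "closed_manifold_over S M \<longleftrightarrow> digital_space M \<and> connected_graph M
     \<and> (\<forall>v\<in>verts M. S (rim M v))"

(* N is a manifold with boundary presented as M - v, and B is the set of points of its
   boundary O(v), transported to N along the isomorphism f. *)
definition bounded_manifold_over :: "('a graph \<Rightarrow> bool) \<Rightarrow> 'a graph \<Rightarrow> 'a set \<Rightarrow> bool" where
  "bounded_manifold_over S N B \<longleftrightarrow> digital_space N \<and> connected_graph N
     \<and> (\<exists>M v f. closed_manifold_over S M \<and> v \<in> verts M
           \<and> graph_iso f (del_point M v) N \<and> B = f ` nbrs M v)"

definition disk_over :: "('a graph \<Rightarrow> bool) \<Rightarrow> 'a graph \<Rightarrow> 'a set \<Rightarrow> bool" where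
  "disk_over S D B \<longleftrightarrow> bounded_manifold_over S D B \<and> contractible_graph D"

definition map_graph :: "('a \<Rightarrow> 'b) \<Rightarrow> 'a graph \<Rightarrow> 'b graph" where
  "map_graph h G = Graph (h ` verts G) (map_prod h h ` edges G)"

(* D # C: the disjoint union of D and C (tagged Inl and Inr) in which every point y of the
   boundary B of C is identified with the point f y of D. *)
definition amalgam :: "'a graph \<Rightarrow> 'b graph \<Rightarrow> 'b set \<Rightarrow> ('b \<Rightarrow> 'a) \<Rightarrow> ('a + 'b) graph" where
  "amalgam D C B f =
     (let D' = map_graph Inl D;
          C' = map_graph (\<lambda>y. if y \<in> B then Inl (f y) else Inr y) C
      in Graph (verts D' \<union> verts C') (edges D' \<union> edges C'))"

fun digital_sphere :: "nat \<Rightarrow> 'a graph \<Rightarrow> bool" where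
  "digital_sphere 0 = zero_sphere"
| "digital_sphere (Suc 0) = one_sphere"
| "digital_sphere (Suc (Suc n)) = (\<lambda>G. digital_space G \<and>
     (\<exists>D BD C BC f h. disk_over (digital_sphere (Suc n)) D BD
        \<and> disk_over (digital_sphere (Suc n)) C BC
        \<and> graph_iso f (induced C BC) (induced D BD)
        \<and> graph_iso h (amalgam D C BC f) G))"

(* Meaningful for n \<ge> 1 only. *)
definition closed_manifold :: "nat \<Rightarrow> 'a graph \<Rightarrow> bool" where
  "closed_manifold n M \<longleftrightarrow> closed_manifold_over (digital_sphere (n - 1)) M"

end

theory Submission imports Defs begin

text \<open>
  Two facts about contractibility carry the proof. First, a space that is the union of two
  contractible subspaces with contractible intersection is contractible. Second, in a closed manifold
  whose rims are spheres that become contractible when any point is removed, \<open>M - v\<close> is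
  contractible for one \<open>v\<close> iff it is for all: for adjacent \<open>v\<close> and \<open>x\<close> both \<open>M - v\<close> and \<open>M - x\<close> can be
  reduced to \<open>M - v - x\<close>, since the rim of \<open>x\<close> in \<open>M - v\<close> is a sphere minus a point.

  By induction on the dimension, a sphere \<open>D # C\<close> is then a closed manifold: the rim of a common
  boundary point is the union of two spheres minus a point, glued along their boundaries, hence a
  sphere of lower dimension. Removing a common boundary point from \<open>D # C\<close> leaves a union as in the
  first fact. Conversely, if \<open>M - v\<close> is contractible, \<open>M\<close> is the union of the disk \<open>M - v\<close> and the
  cone over \<open>O(v)\<close>, which is a disk because the suspension of a sphere is a closed manifold.
\<close>

section \<open>Spaces and contractible transformations\<close>

lemma verts_induced [simp]: "verts (induced G A) = verts G \<inter> A"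
  and edges_induced [simp]: "edges (induced G A) = edges G \<inter> A \<times> A"
  by (simp_all add: induced_def)

lemma verts_del_point [simp]: "verts (del_point G v) = verts G - {v}"
  by (auto simp: del_point_def)

lemma verts_rim [simp]: "verts (rim G v) = verts G \<inter> nbrs G v"
  by (simp add: rim_def)

lemma mem_nbrs [simp]: "y \<in> nbrs G x \<longleftrightarrow> (x, y) \<in> edges G"
  by (simp add: nbrs_def)

lemma digital_spaceD:
  assumes "digital_space G" "(x, y) \<in> edges G"
  shows "x \<in> verts G" "y \<in> verts G" "(y, x) \<in> edges G" "x \<noteq> y"
  using assms by (auto simp: digital_space_def sym_def irrefl_def)

lemma digital_space_finiteI:
  assumes "finite (verts G)"
    and "\<And>x y. (x, y) \<in> edges G \<Longrightarrow> x \<in> verts G \<and> (y, x) \<in> edges G \<and> x \<noteq> y"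
  shows "digital_space G"
  using assms unfolding digital_space_def sym_def irrefl_def
  by (auto intro: countable_finite)

lemma digital_space_induced [simp]: "digital_space G \<Longrightarrow> digital_space (induced G A)"
  unfolding digital_space_def by (auto simp: sym_def irrefl_def)

lemma digital_space_del_point [simp]: "digital_space G \<Longrightarrow> digital_space (del_point G v)"
  and digital_space_rim [simp]: "digital_space G \<Longrightarrow> digital_space (rim G v)"
  by (simp_all add: del_point_def rim_def)

lemma digital_space_del_edge: "digital_space G \<Longrightarrow> digital_space (del_edge G u v)"
  unfolding digital_space_def del_edge_def by (auto simp: sym_def irrefl_def)

lemma digital_space_add_edge:
  "digital_space G \<Longrightarrow> u \<in> verts G \<Longrightarrow> v \<in> verts G \<Longrightarrow> u \<noteq> v \<Longrightarrow> digital_space (add_edge G u v)"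
  unfolding digital_space_def add_edge_def by (auto simp: sym_def irrefl_def)

lemma digital_space_glue_point:
  "digital_space G \<Longrightarrow> v \<notin> verts G \<Longrightarrow> A \<subseteq> verts G \<Longrightarrow> digital_space (glue_point G v A)"
  unfolding digital_space_def glue_point_def by (auto simp: sym_def irrefl_def)

lemma edges_del_point: "digital_space G \<Longrightarrow> edges (del_point G v) = edges G \<inter> (- {v}) \<times> (- {v})"
  by (auto simp: del_point_def dest: digital_spaceD)

lemma induced_induced [simp]: "induced (induced G A) B = induced G (A \<inter> B)"
  by (auto simp: induced_def)

lemma induced_verts [simp]: "digital_space G \<Longrightarrow> induced G (verts G) = G"
  by (cases G) (auto simp: induced_def digital_space_def)

lemma induced_cong: "digital_space G \<Longrightarrow> verts G \<inter> A = verts G \<inter> B \<Longrightarrow> induced G A = induced G B"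
  unfolding induced_def by (auto dest: digital_spaceD)

lemma rim_induced: "x \<in> A \<Longrightarrow> rim (induced G A) x = induced G (A \<inter> nbrs G x)"
  unfolding rim_def induced_induced by (auto simp: induced_def)

lemma del_point_induced: "digital_space G \<Longrightarrow> del_point (induced G A) x = induced G (A - {x})"
  unfolding del_point_def induced_induced by (rule induced_cong) auto


section \<open>Finiteness and connectedness of contractible graphs\<close>

text \<open>Every rule starts from a digital space and changes the vertex set by at most one point,
  so finiteness passes back along a reduction from its final point. Finiteness is what later
  guarantees fresh points in an infinite type.\<close>

lemma contractible_digital_finite:
  "contractible_graph G \<Longrightarrow> digital_space G \<and> finite (verts G)"
  "contractible_trans G H \<Longrightarrow> digital_space G \<and> (finite (verts H) \<longrightarrow> finite (verts G))"
proof (induction rule: contractible_graph_contractible_trans.inducts)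
  case (one_point v)
  then show ?case by (auto simp: digital_space_def sym_def irrefl_def)
qed (auto simp: glue_point_def del_edge_def add_edge_def)

text \<open>Edges only have to go to paths. This allows \<open>r\<close> to collapse a point onto a
  neighbour, and with \<open>r = id\<close> it allows an edge to be replaced by a detour.\<close>

lemma connected_graph_image:
  assumes "connected_graph H" "verts G = r ` verts H"
    and "\<And>x y. (x, y) \<in> edges H \<Longrightarrow> (r x, r y) \<in> (edges G)\<^sup>*"
  shows "connected_graph G"
proof -
  have "(r x, r y) \<in> (edges G)\<^sup>*" if "(x, y) \<in> (edges H)\<^sup>*" for x y
    using that by induction (auto intro: rtrancl_trans assms(3))
  then show ?thesis using assms(1,2) by (auto simp: connected_graph_def)
qed

lemma rtrancl_sym_edges: "digital_space G \<Longrightarrow> (x, y) \<in> (edges G)\<^sup>* \<Longrightarrow> (y, x) \<in> (edges G)\<^sup>*"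
  by (meson digital_space_def sym_rtrancl symD)

lemma rtrancl_induced: "(x, y) \<in> (edges (induced G A))\<^sup>* \<Longrightarrow> (x, y) \<in> (edges G)\<^sup>*"
  by (rule rtrancl_mono[THEN subsetD, rotated]) auto

lemma connected_graphI:
  assumes "digital_space G" "c \<in> verts G" "\<And>x. x \<in> verts G \<Longrightarrow> (c, x) \<in> (edges G)\<^sup>*"
  shows "connected_graph G"
  unfolding connected_graph_def
proof (intro conjI ballI)
  fix u v assume "u \<in> verts G" "v \<in> verts G"
  then show "(u, v) \<in> (edges G)\<^sup>*"
    using rtrancl_sym_edges[OF assms(1) assms(3)] assms(3) by (blast intro: rtrancl_trans)
qed (use assms(2) in auto)

lemma connected_graph_Un:
  assumes "digital_space G" "verts G \<subseteq> U \<union> W" "c \<in> U \<inter> W" "c \<in> verts G"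
    and "connected_graph (induced G U)" "connected_graph (induced G W)"
  shows "connected_graph G"
proof (rule connected_graphI[where c = c])
  fix x assume "x \<in> verts G"
  then show "(c, x) \<in> (edges G)\<^sup>*"
    using assms unfolding connected_graph_def by (metis Int_iff UnE rtrancl_induced subsetD verts_induced)
qed (use assms in auto)

text \<open>Connectedness is carried back from the result of each transformation. A deleted point
  hangs on its nonempty rim, a path through a glued point is rerouted inside the connected rim, and
  an added edge is bypassed through a common neighbour.\<close>

lemma contractible_connected:
  "contractible_graph G \<Longrightarrow> connected_graph G"
  "contractible_trans G H \<Longrightarrow> connected_graph H \<longrightarrow> connected_graph G"
proof (induction rule: contractible_graph_contractible_trans.inducts)
  case (one_point v)
  then show ?case by (simp add: connected_graph_def)
next
  case (step G H)
  then show ?case by simp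
next
  case (point_deletion G v)
  show ?case
  proof
    assume c: "connected_graph (del_point G v)"
    obtain a where a: "(v, a) \<in> edges G" "a \<in> verts G"
      using point_deletion.IH by (auto simp: connected_graph_def)
    have d: "digital_space G" by fact
    show "connected_graph G"
    proof (rule connected_graphI[where c = a])
      fix x assume x: "x \<in> verts G"
      show "(a, x) \<in> (edges G)\<^sup>*"
      proof (cases "x = v")
        case True
        then show ?thesis using digital_spaceD(3)[OF d a(1)] by auto
      next
        case False
        then have "(a, x) \<in> (edges (del_point G v))\<^sup>*"
          using c x a digital_spaceD(4)[OF d a(1)] unfolding connected_graph_def by auto
        then show ?thesis unfolding del_point_def by (rule rtrancl_induced)
      qed
    qed (use d a in auto)
  qed
next
  case (point_gluing G v A)
  then obtain a where a: "a \<in> A" "a \<in> verts G" by (auto simp: connected_graph_def)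
  have r: "(a, x) \<in> (edges G)\<^sup>*" if "x \<in> A" for x
  proof -
    have "(a, x) \<in> (edges (induced G A))\<^sup>*"
      using that a point_gluing unfolding connected_graph_def by auto
    then show ?thesis by (rule rtrancl_induced)
  qed
  show ?case
  proof
    assume c: "connected_graph (glue_point G v A)"
    \<comment> \<open>The glued point is retracted to a point \<open>a\<close> of its rim, so an
      edge at \<open>v\<close> becomes a path within \<open>A\<close>.\<close>
    show "connected_graph G"
    proof (rule connected_graph_image[OF c, where r = "\<lambda>x. if x = v then a else x"])
      show "verts G = (\<lambda>x. if x = v then a else x) ` verts (glue_point G v A)"
        using a point_gluing.hyps by (auto simp: glue_point_def image_iff)
      fix x y assume "(x, y) \<in> edges (glue_point G v A)"
      then consider "(x, y) \<in> edges G" | "x = v" "y \<in> A" | "x \<in> A" "y = v"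
        by (auto simp: glue_point_def)
      then show "(if x = v then a else x, if y = v then a else y) \<in> (edges G)\<^sup>*"
      proof cases
        case 1
        then have "x \<noteq> v" "y \<noteq> v"
          using point_gluing.hyps(2) digital_spaceD(1,2)[OF point_gluing.hyps(1) 1] by auto
        then show ?thesis using 1 by auto
      qed (use r rtrancl_sym_edges[OF point_gluing.hyps(1)] in auto)
    qed
  qed
next
  case (edge_deletion G u v)
  show ?case
  proof
    assume c: "connected_graph (del_edge G u v)"
    show "connected_graph G"
      by (rule connected_graph_image[OF c, where r = id]) (auto simp: del_edge_def)
  qed
next
  case (edge_addition G u v)
  then obtain z where z: "(u, z) \<in> edges G" "(v, z) \<in> edges G"
    by (auto simp: connected_graph_def common_rim_def)
  then have "(u, v) \<in> (edges G)\<^sup>*" "(v, u) \<in> (edges G)\<^sup>*"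
    using digital_spaceD(3)[OF edge_addition.hyps(1)] by (meson r_into_rtrancl rtrancl.rtrancl_into_rtrancl)+
  show ?case
  proof
    assume c: "connected_graph (add_edge G u v)"
    show "connected_graph G"
      by (rule connected_graph_image[OF c, where r = id])
        (use \<open>(u, v) \<in> (edges G)\<^sup>*\<close> \<open>(v, u) \<in> (edges G)\<^sup>*\<close> in \<open>auto simp: add_edge_def\<close>)
  qed
qed

section \<open>Isomorphisms\<close>

lemma graph_iso_comp: "graph_iso f G H \<Longrightarrow> graph_iso g H K \<Longrightarrow> graph_iso (g \<circ> f) G K"
  unfolding graph_iso_def by (auto intro: bij_betw_trans dest: bij_betwE)

lemma graph_iso_induced:
  assumes "graph_iso f G H" "A \<subseteq> verts G" "B = f ` A"
  shows "graph_iso f (induced G A) (induced H B)"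
proof -
  have "verts G \<inter> A = A" "verts H \<inter> B = B" using assms by (auto simp: graph_iso_def bij_betw_def)
  moreover have "bij_betw f A B"
    using assms by (auto simp: graph_iso_def intro: bij_betw_subset)
  moreover have "(x, y) \<in> edges (induced G A) \<longleftrightarrow> (f x, f y) \<in> edges (induced H B)"
    if "x \<in> A" "y \<in> A" for x y
    using assms that unfolding graph_iso_def by auto
  ultimately show ?thesis
    unfolding graph_iso_def by simp
qed

lemma graph_iso_adj:
  "graph_iso f G H \<Longrightarrow> x \<in> verts G \<Longrightarrow> y \<in> verts G \<Longrightarrow> (f x, f y) \<in> edges H \<longleftrightarrow> (x, y) \<in> edges G"
  by (simp add: graph_iso_def)

lemma graph_iso_verts: "graph_iso f G H \<Longrightarrow> verts H = f ` verts G"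
  by (auto simp: graph_iso_def bij_betw_def)

lemma graph_iso_nbrs:
  assumes "graph_iso f G H" "digital_space G" "digital_space H" "v \<in> verts G"
  shows "nbrs H (f v) = f ` nbrs G v"
proof -
  have e: "(f v, f y) \<in> edges H \<longleftrightarrow> (v, y) \<in> edges G" if "y \<in> verts G" for y
    using graph_iso_adj[OF assms(1,4) that] .
  have "nbrs H (f v) \<subseteq> f ` verts G"
    using digital_spaceD(2)[OF assms(3)] graph_iso_verts[OF assms(1)] by auto
  moreover have "nbrs G v \<subseteq> verts G" using digital_spaceD(2)[OF assms(2)] by auto
  ultimately show ?thesis using e by (auto simp: subset_iff)
qed

lemma graph_iso_rim:
  assumes "graph_iso f G H" "digital_space G" "digital_space H" "v \<in> verts G"
  shows "graph_iso f (rim G v) (rim H (f v))"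
  unfolding rim_def using assms graph_iso_nbrs[OF assms]
  by (intro graph_iso_induced) (auto dest: digital_spaceD)

lemma graph_iso_del_point:
  assumes "graph_iso f G H" "v \<in> verts G"
  shows "graph_iso f (del_point G v) (del_point H (f v))"
proof -
  have "verts H - {f v} = f ` (verts G - {v})"
    using assms by (auto simp: graph_iso_def bij_betw_def inj_on_def)
  then show ?thesis unfolding del_point_def using assms by (intro graph_iso_induced) auto
qed

lemma graph_iso_common_rim:
  assumes "graph_iso f G H" "digital_space G" "digital_space H" "u \<in> verts G" "v \<in> verts G"
  shows "graph_iso f (common_rim G u v) (common_rim H (f u) (f v))"
proof -
  have "nbrs G u \<subseteq> verts G" "nbrs G v \<subseteq> verts G" using assms by (auto dest: digital_spaceD)
  then have "f ` nbrs G u \<inter> f ` nbrs G v = f ` (nbrs G u \<inter> nbrs G v)"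
    using assms(1) by (metis graph_iso_def bij_betw_def inj_on_image_Int)
  then have "nbrs H (f u) \<inter> nbrs H (f v) = f ` (nbrs G u \<inter> nbrs G v)"
    using assms graph_iso_nbrs by metis
  then show ?thesis unfolding common_rim_def using assms(1) \<open>nbrs G u \<subseteq> verts G\<close>
    by (intro graph_iso_induced) auto
qed

lemma graph_iso_eq_iff:
  "graph_iso f G H \<Longrightarrow> x \<in> verts G \<Longrightarrow> y \<in> verts G \<Longrightarrow> f x = f y \<longleftrightarrow> x = y"
  by (auto simp: graph_iso_def bij_betw_def inj_on_def)

lemma graph_iso_del_edge:
  assumes "graph_iso f G H" "u \<in> verts G" "v \<in> verts G"
  shows "graph_iso f (del_edge G u v) (del_edge H (f u) (f v))"
proof -
  have "(x, y) \<in> edges (del_edge G u v) \<longleftrightarrow> (f x, f y) \<in> edges (del_edge H (f u) (f v))"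
    if "x \<in> verts G" "y \<in> verts G" for x y
    using that assms by (simp add: del_edge_def graph_iso_adj graph_iso_eq_iff)
  then show ?thesis using assms(1) by (simp add: graph_iso_def del_edge_def)
qed

lemma graph_iso_add_edge:
  assumes "graph_iso f G H" "u \<in> verts G" "v \<in> verts G"
  shows "graph_iso f (add_edge G u v) (add_edge H (f u) (f v))"
proof -
  have "(x, y) \<in> edges (add_edge G u v) \<longleftrightarrow> (f x, f y) \<in> edges (add_edge H (f u) (f v))"
    if "x \<in> verts G" "y \<in> verts G" for x y
    using that assms by (simp add: add_edge_def graph_iso_adj graph_iso_eq_iff)
  then show ?thesis using assms(1) by (simp add: graph_iso_def add_edge_def)
qed

lemma graph_iso_glue_point:
  assumes i: "graph_iso f G H" and d: "digital_space G" "digital_space H"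
    and v: "v \<notin> verts G" and w: "w \<notin> verts H" and A: "A \<subseteq> verts G"
  shows "graph_iso (f(v := w)) (glue_point G v A) (glue_point H w (f ` A))"
proof -
  have "bij_betw (f(v := w)) (verts G) (verts H)"
    using i v by (subst bij_betw_cong[where g = f]) (auto simp: graph_iso_def)
  then have "bij_betw (f(v := w)) (insert v (verts G)) (insert w (verts H))"
    using notIn_Un_bij_betw3[of v "verts G" "f(v := w)" "verts H"] v w by auto
  moreover have "(x, y) \<in> edges (glue_point G v A) \<longleftrightarrow>
      ((f(v := w)) x, (f(v := w)) y) \<in> edges (glue_point H w (f ` A))"
    if xy: "x \<in> insert v (verts G)" "y \<in> insert v (verts G)" for x y
  proof -
    have im: "f z \<in> f ` A \<longleftrightarrow> z \<in> A" and nw': "f z \<noteq> w" if "z \<in> verts G" for z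
      using that A w graph_iso_verts[OF i] graph_iso_eq_iff[OF i] by auto
    have e: "(f x, f y) \<in> edges H \<longleftrightarrow> (x, y) \<in> edges G" if "x \<in> verts G" "y \<in> verts G"
      using graph_iso_adj[OF i] that .
    have nw: "(w, z) \<notin> edges H" "(z, w) \<notin> edges H" for z using w d by (auto dest: digital_spaceD)
    have nv: "(v, z) \<notin> edges G" "(z, v) \<notin> edges G" for z using v d by (auto dest: digital_spaceD)
    have vA: "v \<notin> A" and wA: "w \<notin> f ` A" using v w A graph_iso_verts[OF i] by auto
    consider "x = v" "y = v" | "x = v" "y \<noteq> v" "y \<in> verts G" | "x \<noteq> v" "y = v" "x \<in> verts G"
      | "x \<noteq> v" "y \<noteq> v" "x \<in> verts G" "y \<in> verts G" using xy by auto
    then show ?thesis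
      by cases (simp_all add: glue_point_def e im nw nv nw' vA wA)
  qed
  ultimately show ?thesis by (simp add: graph_iso_def glue_point_def)
qed

text \<open>A reduction of \<open>G\<close> is mirrored in \<open>G'\<close>. The point glued to
  \<open>G\<close> has no image yet and needs a fresh partner in \<open>G'\<close>, so the
  isomorphism changes along the way; hence the existential in the second claim. Finiteness provides
  the fresh point, and \<open>digital_space G'\<close> excludes edges outside the vertex set, about
  which \<open>graph_iso\<close> says nothing.\<close>

lemma contractible_iso_aux:
  fixes G :: "'a graph"
  shows "contractible_graph G \<Longrightarrow>
      \<forall>(f :: 'a \<Rightarrow> 'b::infinite) G'. graph_iso f G G' \<longrightarrow> digital_space G' \<longrightarrow> contractible_graph G'"
  and "contractible_trans G H \<Longrightarrow>
      \<forall>(f :: 'a \<Rightarrow> 'b::infinite) G'. graph_iso f G G' \<longrightarrow> digital_space G' \<longrightarrow> finite (verts G) \<longrightarrow>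
        (\<exists>f' H'. graph_iso f' H H' \<and> digital_space H' \<and> contractible_trans G' H')"
proof (induction rule: contractible_graph_contractible_trans.inducts)
  case (one_point v)
  show ?case
  proof (intro allI impI)
    fix f :: "'a \<Rightarrow> 'b" and G'
    assume i: "graph_iso f (Graph {v} {}) G'" and d: "digital_space G'"
    have v: "verts G' = {f v}" using graph_iso_verts[OF i] by simp
    have "edges G' = {}" using d v by (auto simp: digital_space_def irrefl_def)
    then have "G' = Graph {f v} {}" using v by (cases G') auto
    then show "contractible_graph G'" by (simp add: contractible_graph_contractible_trans.one_point)
  qed
next
  case (step G H)
  show ?case
  proof (intro allI impI)
    fix f :: "'a \<Rightarrow> 'b" and G'
    assume i: "graph_iso f G G'" and d: "digital_space G'"
    have "finite (verts G)"
      using step.hyps contractible_digital_finite by blast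
    then show "contractible_graph G'"
      using step.IH i d by (meson contractible_graph_contractible_trans.step)
  qed
next
  case (point_deletion G v)
  show ?case
  proof (intro allI impI)
    fix f :: "'a \<Rightarrow> 'b" and G'
    assume i: "graph_iso f G G'" and d: "digital_space G'"
    have "contractible_graph (rim G' (f v))"
      using point_deletion.IH graph_iso_rim[OF i point_deletion.hyps(1) d point_deletion.hyps(2)] d
      by (meson digital_space_rim)
    moreover have "f v \<in> verts G'" using i point_deletion.hyps graph_iso_verts by blast
    ultimately have "contractible_trans G' (del_point G' (f v))"
      using d by (intro contractible_graph_contractible_trans.point_deletion)
    then show "\<exists>f' H'. graph_iso f' (del_point G v) H' \<and> digital_space H' \<and> contractible_trans G' H'"
      using graph_iso_del_point[OF i] point_deletion.hyps d by (metis digital_space_del_point)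
  qed
next
  case (point_gluing G v A)
  show ?case
  proof (intro allI impI)
    fix f :: "'a \<Rightarrow> 'b" and G'
    assume i: "graph_iso f G G'" and d: "digital_space G'" and fin: "finite (verts G)"
    have "finite (verts G')" using graph_iso_verts[OF i] fin by simp
    then obtain w where w: "w \<notin> verts G'" using ex_new_if_finite[OF infinite_UNIV] by blast
    have A': "f ` A \<subseteq> verts G'" using graph_iso_verts[OF i] point_gluing.hyps by auto
    have "contractible_graph (induced G' (f ` A))"
      using point_gluing.IH graph_iso_induced[OF i point_gluing.hyps(3) refl] d
      by (meson digital_space_induced)
    then have t: "contractible_trans G' (glue_point G' w (f ` A))"
      using d w A' by (intro contractible_graph_contractible_trans.point_gluing)
    have "graph_iso (f(v := w)) (glue_point G v A) (glue_point G' w (f ` A))"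
      using i point_gluing.hyps(1) d point_gluing.hyps(2) w point_gluing.hyps(3)
      by (rule graph_iso_glue_point)
    moreover have "digital_space (glue_point G' w (f ` A))"
      using d w A' by (rule digital_space_glue_point)
    ultimately show "\<exists>f' H'. graph_iso f' (glue_point G v A) H' \<and> digital_space H' \<and> contractible_trans G' H'"
      using t by (intro exI conjI)
  qed
next
  case (edge_deletion G u v)
  show ?case
  proof (intro allI impI)
    fix f :: "'a \<Rightarrow> 'b" and G'
    assume i: "graph_iso f G G'" and d: "digital_space G'"
    have uv: "u \<in> verts G" "v \<in> verts G" using edge_deletion.hyps by (auto dest: digital_spaceD)
    have "contractible_graph (common_rim G' (f u) (f v))"
      using edge_deletion.IH graph_iso_common_rim[OF i edge_deletion.hyps(1) d uv] d
      by (auto simp: common_rim_def)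
    moreover have "(f u, f v) \<in> edges G'" using graph_iso_adj[OF i uv] edge_deletion.hyps by simp
    ultimately have "contractible_trans G' (del_edge G' (f u) (f v))"
      using d by (intro contractible_graph_contractible_trans.edge_deletion)
    moreover have "graph_iso f (del_edge G u v) (del_edge G' (f u) (f v))"
      using i uv by (rule graph_iso_del_edge)
    ultimately show "\<exists>f' H'. graph_iso f' (del_edge G u v) H' \<and> digital_space H' \<and> contractible_trans G' H'"
      using digital_space_del_edge[OF d] by (intro exI conjI)
  qed
next
  case (edge_addition G u v)
  show ?case
  proof (intro allI impI)
    fix f :: "'a \<Rightarrow> 'b" and G'
    assume i: "graph_iso f G G'" and d: "digital_space G'"
    note uv = edge_addition.hyps(2,3)
    have "contractible_graph (common_rim G' (f u) (f v))"
      using edge_addition.IH graph_iso_common_rim[OF i edge_addition.hyps(1) d uv] d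
      by (auto simp: common_rim_def)
    moreover have "(f u, f v) \<notin> edges G'" using graph_iso_adj[OF i uv] edge_addition.hyps by simp
    moreover have uv': "f u \<in> verts G'" "f v \<in> verts G'" using uv graph_iso_verts[OF i] by auto
    moreover have ne: "f u \<noteq> f v" using i uv edge_addition.hyps(4)
      by (auto simp: graph_iso_def bij_betw_def inj_on_def)
    ultimately have "contractible_trans G' (add_edge G' (f u) (f v))"
      using d by (intro contractible_graph_contractible_trans.edge_addition)
    moreover have "graph_iso f (add_edge G u v) (add_edge G' (f u) (f v))"
      using i uv by (rule graph_iso_add_edge)
    ultimately show "\<exists>f' H'. graph_iso f' (add_edge G u v) H' \<and> digital_space H' \<and> contractible_trans G' H'"
      using digital_space_add_edge[OF d uv' ne] by (intro exI conjI)
  qed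
qed

lemma contractible_iso:
  fixes f :: "'a \<Rightarrow> 'b::infinite"
  shows "contractible_graph G \<Longrightarrow> graph_iso f G G' \<Longrightarrow> digital_space G' \<Longrightarrow> contractible_graph G'"
  using contractible_iso_aux(1) by blast

section \<open>Contractible unions\<close>

lemma contractible_del_pointI:
  assumes "digital_space G" "x \<in> verts G" "contractible_graph (rim G x)" "contractible_graph (del_point G x)"
  shows "contractible_graph G"
  using contractible_graph_contractible_trans.point_deletion[OF assms(1-3)] assms(4)
  by (rule contractible_graph_contractible_trans.step)

lemma glue_point_del_point:
  assumes "digital_space G" "x \<in> verts G"
  shows "glue_point (del_point G x) x (nbrs G x) = G"
proof -
  have "edges (del_point G x) \<union> {x} \<times> nbrs G x \<union> nbrs G x \<times> {x} = edges G"
    using digital_spaceD(3)[OF assms(1)] by (auto simp: edges_del_point[OF assms(1)])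
  moreover have "insert x (verts (del_point G x)) = verts G" using assms(2) by auto
  ultimately show ?thesis unfolding glue_point_def by (cases G) simp
qed

text \<open>Gluing \<open>x\<close> back with its old rim is itself a contractible transformation,
  so a reduction of \<open>del_point G x\<close> may return to \<open>G\<close> first and then
  follow the reduction of \<open>G\<close>.\<close>

lemma contractible_del_point:
  assumes "digital_space G" "x \<in> verts G" "contractible_graph (rim G x)" "contractible_graph G"
  shows "contractible_graph (del_point G x)"
proof -
  have "nbrs G x \<subseteq> verts (del_point G x)"
    using digital_spaceD(2)[OF assms(1)] digital_spaceD(4)[OF assms(1), of x x] by auto
  moreover from this have "induced (del_point G x) (nbrs G x) = rim G x"
    unfolding del_point_def rim_def induced_induced
    by (intro induced_cong[OF assms(1)]) auto
  ultimately have "contractible_trans (del_point G x) (glue_point (del_point G x) x (nbrs G x))"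
    using assms by (intro contractible_graph_contractible_trans.point_gluing) auto
  then show ?thesis
    using assms glue_point_del_point[OF assms(1,2)]
    by (metis contractible_graph_contractible_trans.step)
qed

section \<open>Cones, dominated points and unions\<close>

lemma contractible_singleton:
  assumes "digital_space G" "verts G = {v}"
  shows "contractible_graph G"
proof -
  have "edges G = {}" using digital_spaceD[OF assms(1)] assms(2) by fastforce
  then have "G = Graph {v} {}" using assms(2) by (cases G) auto
  then show ?thesis by (simp add: contractible_graph_contractible_trans.one_point)
qed

text \<open>Induction on the number of points: for \<open>x\<close> other than the apex, both the
  rim of \<open>x\<close> and the space without \<open>x\<close> are smaller cones with apex
  \<open>p\<close>, so \<open>x\<close> can be deleted.\<close>

lemma contractible_cone:
  assumes "digital_space G" "finite (verts G)" "p \<in> verts G" "\<And>x. x \<in> verts G \<Longrightarrow> x \<noteq> p \<Longrightarrow> (p, x) \<in> edges G"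
  shows "contractible_graph G"
  using assms
proof (induction "card (verts G)" arbitrary: G rule: less_induct)
  case less
  show ?case
  proof (cases "verts G = {p}")
    case True
    with less.prems(1) show ?thesis by (rule contractible_singleton)
  next
    case False
    then obtain x where x: "x \<in> verts G" "x \<noteq> p" using less.prems(3) by auto
    have xp: "(x, p) \<in> edges G" using digital_spaceD(3)[OF less.prems(1) less.prems(4)[OF x]] .
    have "x \<notin> verts (rim G x)" using digital_spaceD(4)[OF less.prems(1)] by auto
    then have "verts (rim G x) \<subset> verts G" using x by auto
    moreover have "verts (del_point G x) \<subset> verts G" using x by auto
    ultimately have lt: "card (verts (rim G x)) < card (verts G)" "card (verts (del_point G x)) < card (verts G)"
      using psubset_card_mono[OF less.prems(2)] by blast+
    have "contractible_graph (rim G x)"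
      by (rule less.hyps[OF lt(1)]) (use less.prems xp in \<open>auto simp: rim_def dest: digital_spaceD\<close>)
    moreover have "contractible_graph (del_point G x)"
      by (rule less.hyps[OF lt(2)]) (use less.prems x in \<open>auto simp: edges_del_point\<close>)
    ultimately show ?thesis by (rule contractible_del_pointI[OF less.prems(1) x(1)])
  qed
qed

text \<open>The rim of each point of \<open>X\<close> is a cone with apex \<open>p\<close>.\<close>

lemma contractible_delete_dominated:
  assumes "finite X" "digital_space G" "finite (verts G)" "p \<in> verts G" "X \<subseteq> verts G" "p \<notin> X"
    and "\<And>x. x \<in> X \<Longrightarrow> (x, p) \<in> edges G"
    and "\<And>x y. x \<in> X \<Longrightarrow> (x, y) \<in> edges G \<Longrightarrow> y = p \<or> (p, y) \<in> edges G"
    and "contractible_graph (induced G (verts G - X))"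
  shows "contractible_graph G"
  using assms
proof (induction X arbitrary: G rule: finite_induct)
  case empty
  then show ?case by simp
next
  case (insert x X)
  note d = \<open>digital_space G\<close>
  have "contractible_graph (rim G x)"
    by (rule contractible_cone[where p = p])
      (use insert.prems digital_spaceD(2)[OF d] in \<open>auto simp: rim_def\<close>)
  moreover have "contractible_graph (del_point G x)"
  proof (rule insert.IH)
    have "verts (del_point G x) - X = verts G - insert x X" by auto
    then have "induced (del_point G x) (verts (del_point G x) - X) = induced G (verts G - insert x X)"
      unfolding del_point_def induced_induced using d by (intro induced_cong) auto
    then show "contractible_graph (induced (del_point G x) (verts (del_point G x) - X))"
      using insert.prems by simp
  next
    fix x' y assume "x' \<in> X" "(x', y) \<in> edges (del_point G x)"
    then show "y = p \<or> (p, y) \<in> edges (del_point G x)"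
      using insert.prems(5,7) by (auto simp: edges_del_point[OF d])
  next
    show "X \<subseteq> verts (del_point G x)" using insert.prems(4) insert.hyps(2) by auto
    show "(x', p) \<in> edges (del_point G x)" if "x' \<in> X" for x'
      using that insert.prems(5,6) insert.hyps(2) by (auto simp: edges_del_point[OF d])
    show "digital_space (del_point G x)" using d by simp
    show "finite (verts (del_point G x))" "p \<in> verts (del_point G x)" "p \<notin> X"
      using insert.prems(2,3,5) by auto
  qed
  moreover have "x \<in> verts G" using insert.prems(4) by simp
  ultimately show ?case using contractible_del_pointI[OF d] by simp
qed

text \<open>The internal form of \<open>D # C\<close>: no edge joins \<open>U - W\<close> to
  \<open>W - U\<close>, so \<open>G\<close> arises from its subspaces on \<open>U\<close> and
  \<open>W\<close> by gluing them along \<open>U \<inter> W\<close>. No tags are involved.\<close>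

definition splits :: "'a graph \<Rightarrow> 'a set \<Rightarrow> 'a set \<Rightarrow> bool" where
  "splits G U W \<longleftrightarrow> digital_space G \<and> verts G = U \<union> W \<and> edges G \<subseteq> U \<times> U \<union> W \<times> W"

lemma splits_sym: "splits G U W \<Longrightarrow> splits G W U"
  unfolding splits_def by auto

text \<open>Glue a point \<open>p\<close> with rim \<open>W\<close>; then every point of \<open>W - U\<close> is dominated by \<open>p\<close> and can be
  deleted, which leaves \<open>p\<close> with rim \<open>U \<inter> W\<close>.\<close>

lemma contractible_Un:
  fixes G :: "'a::infinite graph"
  assumes s: "splits G U W" and U: "contractible_graph (induced G U)"
    and W: "contractible_graph (induced G W)" and UW: "contractible_graph (induced G (U \<inter> W))"
  shows "contractible_graph G"
proof -
  have d: "digital_space G" and V: "verts G = U \<union> W" and E: "edges G \<subseteq> U \<times> U \<union> W \<times> W"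
    using s by (auto simp: splits_def)
  have "finite (verts G \<inter> U)" "finite (verts G \<inter> W)"
    using U W contractible_digital_finite(1) by fastforce+
  then have fin: "finite (verts G)" using V by (simp add: Int_absorb1)
  then obtain p where p: "p \<notin> verts G" using ex_new_if_finite[OF infinite_UNIV] by blast
  let ?H = "glue_point G p W"
  have WV: "W \<subseteq> verts G" using V by auto
  have dH: "digital_space ?H" using d p WV by (rule digital_space_glue_point)
  have VH: "verts ?H = insert p (verts G)"
    and EH: "edges ?H = edges G \<union> {p} \<times> W \<union> W \<times> {p}" by (simp_all add: glue_point_def)
  \<comment> \<open>A point of \<open>W - U\<close> has all its neighbours in \<open>W\<close>, and
    \<open>p\<close> is joined to all of \<open>W\<close>; this is the domination needed
    below.\<close>
  have eU: "y \<in> W" if "(x, y) \<in> edges G" "x \<in> W - U" for x y using that E by auto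
  have "contractible_graph ?H"
  proof (rule contractible_delete_dominated[where X = "W - U" and p = p])
    let ?K = "induced ?H (verts ?H - (W - U))"
    have pU: "p \<notin> U" using p V by auto
    have "contractible_graph ?K"
    proof (rule contractible_del_pointI[where x = p])
      have "del_point ?K p = induced G U"
        unfolding del_point_def induced_induced using p V by (auto simp: induced_def VH EH)
      then show "contractible_graph (del_point ?K p)" using U by simp
      have "p \<in> verts ?H - (W - U)" using p V VH by auto
      then have "rim ?K p = induced ?H ((verts ?H - (W - U)) \<inter> nbrs ?H p)" by (rule rim_induced)
      also have "\<dots> = induced G (U \<inter> W)"
      proof -
        have "(p, y) \<notin> edges G" for y using p d by (auto dest: digital_spaceD)
        then have "nbrs ?H p = W" using p V by (auto simp: EH)
        then show ?thesis using p V by (auto simp: induced_def VH EH)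
      qed
      finally show "contractible_graph (rim ?K p)" using UW by simp
      show "p \<in> verts ?K" using p V VH by simp
    qed (rule digital_space_induced[OF dH])
    then show "contractible_graph ?K" .
  next
    fix x y assume x: "x \<in> W - U" and "(x, y) \<in> edges ?H"
    then show "y = p \<or> (p, y) \<in> edges ?H" using eU[of x y] p V by (auto simp: EH)
  qed (use fin dH VH p V in \<open>auto simp: EH\<close>)
  moreover have "contractible_trans G ?H"
    using d p WV W by (rule contractible_graph_contractible_trans.point_gluing)
  ultimately show ?thesis by (metis contractible_graph_contractible_trans.step)
qed

text \<open>It suffices to move the removed point to a neighbour; connectedness then carries it
  along a path to any other point.\<close>

lemma contractible_del_point_all:
  assumes d: "digital_space M" and c: "connected_graph M"
    and rim: "\<And>x y. (x, y) \<in> edges M \<Longrightarrow> contractible_graph (del_point (rim M x) y)"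
    and v: "v \<in> verts M" "contractible_graph (del_point M v)" and x: "x \<in> verts M"
  shows "contractible_graph (del_point M x)"
proof -
  have step: "contractible_graph (del_point M z)"
    if y: "contractible_graph (del_point M y)" and e: "(y, z) \<in> edges M" for y z
  proof -
    have e': "(z, y) \<in> edges M" and V: "y \<in> verts M" "z \<in> verts M" and ne: "y \<noteq> z"
      using digital_spaceD[OF d e] by auto
    have r: "rim (del_point M p) q = del_point (rim M q) p" if "q \<noteq> p" "q \<in> verts M" for p q
    proof -
      have "q \<in> verts M - {p}" using that by auto
      then show ?thesis
        unfolding rim_def[of M] del_point_induced[OF d] unfolding del_point_def
        by (subst rim_induced) (auto intro: induced_cong[OF d])
    qed
    \<comment> \<open>Descend from \<open>M - y\<close> to \<open>M - y - z\<close>, then climb to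
      \<open>M - z\<close>. The rim used is that of \<open>z\<close> without \<open>y\<close> on the
      way down, and that of \<open>y\<close> without \<open>z\<close> on the way up.\<close>
    have "contractible_graph (del_point (del_point M y) z)"
      by (rule contractible_del_point) (use d y V ne r rim e' in auto)
    also have "del_point (del_point M y) z = del_point (del_point M z) y"
      unfolding del_point_def induced_induced by (rule induced_cong[OF d]) auto
    finally show ?thesis
      by (rule contractible_del_pointI[rotated 3]) (use d V ne r rim e in auto)
  qed
  have "(v, x) \<in> (edges M)\<^sup>*" using c v x by (simp add: connected_graph_def)
  then show ?thesis by induction (use v step in auto)
qed

section \<open>Gluing punctured manifolds\<close>

text \<open>The subspace \<open>U\<close> of \<open>G\<close> is a copy of \<open>A - a\<close> in which the rim of \<open>a\<close> corresponds to \<open>B\<close>.\<close>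

definition punctured ::
  "'a graph \<Rightarrow> 'a \<Rightarrow> ('a \<Rightarrow> 'b) \<Rightarrow> 'b graph \<Rightarrow> 'b set \<Rightarrow> 'b set \<Rightarrow> bool" where
  "punctured A a f G U B \<longleftrightarrow> digital_space A \<and> a \<in> verts A \<and> digital_space G \<and> U \<subseteq> verts G
     \<and> graph_iso f (del_point A a) (induced G U) \<and> B = f ` nbrs A a"

lemma rim_del_point:
  "digital_space A \<Longrightarrow> x \<in> verts A \<Longrightarrow> x \<noteq> a \<Longrightarrow> rim (del_point A a) x = del_point (rim A x) a"
  unfolding rim_def[of A] del_point_induced
  by (simp add: del_point_def rim_induced) (rule induced_cong, auto)

lemma del_point_idem: "digital_space A \<Longrightarrow> a \<notin> verts A \<Longrightarrow> del_point A a = A"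
  by (simp add: del_point_def)

lemma punctured_image_verts:
  assumes "punctured A a f G U B" shows "f ` (verts A - {a}) = U"
proof -
  have "graph_iso f (del_point A a) (induced G U)" "U \<subseteq> verts G" using assms by (auto simp: punctured_def)
  from graph_iso_verts[OF this(1)] this(2) show ?thesis by auto
qed

lemma punctured_mem:
  assumes "punctured A a f G U B" "x \<in> verts A" "x \<noteq> a"
  shows "f x \<in> B \<longleftrightarrow> x \<in> nbrs A a"
proof -
  have i: "graph_iso f (del_point A a) (induced G U)" and d: "digital_space A" and B: "B = f ` nbrs A a"
    using assms(1) by (auto simp: punctured_def)
  have nb: "nbrs A a \<subseteq> verts A - {a}"
    using digital_spaceD(2)[OF d] digital_spaceD(4)[OF d, of a a] by auto
  have "f x = f y \<longleftrightarrow> x = y" if "y \<in> nbrs A a" for y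
    using graph_iso_eq_iff[OF i, of x y] assms(2,3) subsetD[OF nb that] by simp
  then show ?thesis unfolding B by (auto simp: image_iff)
qed

text \<open>The part of the rim of \<open>f x\<close> that lies in \<open>U\<close> is seen inside
  the copy of \<open>A - a\<close>, where the rim of \<open>x\<close> is its rim in \<open>A\<close>
  with \<open>a\<close> removed. This covers interior and boundary points alike.\<close>

lemma punctured_rim_iso:
  assumes "punctured A a f G U B" "x \<in> verts A" "x \<noteq> a"
  shows "graph_iso f (del_point (rim A x) a) (induced (rim G (f x)) (U \<inter> nbrs G (f x)))"
proof -
  have i: "graph_iso f (del_point A a) (induced G U)" and d: "digital_space A" "digital_space G"
    using assms(1) by (auto simp: punctured_def)
  have "f x \<in> U" using punctured_image_verts[OF assms(1)] assms(2,3) by auto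
  then have "rim (induced G U) (f x) = induced (rim G (f x)) (U \<inter> nbrs G (f x))"
    by (simp add: rim_induced) (simp add: rim_def Int_ac)
  then show ?thesis
    using graph_iso_rim[OF i, of x] d assms(2,3) by (simp add: rim_del_point)
qed

lemma punctured_rim_interior:
  assumes p: "punctured A a f G U B" "x \<in> verts A" "x \<noteq> a"
    and "x \<notin> nbrs A a" "nbrs G (f x) \<subseteq> U"
  shows "graph_iso f (rim A x) (rim G (f x))"
proof -
  have d: "digital_space A" "digital_space G" using p by (auto simp: punctured_def)
  have "(x, a) \<notin> edges A" using assms(4) digital_spaceD(3)[OF d(1)] by auto
  then have "del_point (rim A x) a = rim A x" using d by (intro del_point_idem) auto
  moreover have "induced (rim G (f x)) (U \<inter> nbrs G (f x)) = rim G (f x)"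
    using assms(5) unfolding rim_def induced_induced by (simp add: Int_absorb1)
  ultimately show ?thesis using punctured_rim_iso[OF p] by simp
qed

text \<open>Puncturing passes to rims: \<open>a\<close> lies in the rim of a boundary point
  \<open>x\<close>, so within \<open>U\<close> the rim of \<open>f x\<close> is a copy of the rim of
  \<open>x\<close> punctured at the same \<open>a\<close>. This is how gluing descends by one
  dimension.\<close>

lemma punctured_rim_boundary:
  assumes p: "punctured A a f G U B" and x: "x \<in> nbrs A a"
  shows "punctured (rim A x) a f (rim G (f x)) (U \<inter> nbrs G (f x)) (B \<inter> nbrs G (f x))"
proof -
  have d: "digital_space A" "digital_space G" and B: "B = f ` nbrs A a" and U: "U \<subseteq> verts G"
    and i: "graph_iso f (del_point A a) (induced G U)"
    using p by (auto simp: punctured_def)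
  have xa: "(a, x) \<in> edges A" "(x, a) \<in> edges A" "x \<in> verts A" "x \<noteq> a" "a \<in> verts A"
    using x digital_spaceD[OF d(1), of a x] by auto
  have nb: "nbrs A a \<subseteq> verts A - {a}"
    using digital_spaceD(2)[OF d(1)] digital_spaceD(4)[OF d(1), of a a] by auto
  have V: "f ` (verts A - {a}) = U" by (rule punctured_image_verts[OF p])
  have e: "(f x, f y) \<in> edges G \<longleftrightarrow> (x, y) \<in> edges A" if "y \<in> verts A" "y \<noteq> a" for y
  proof -
    have "f x \<in> U" "f y \<in> U" using V that xa by auto
    moreover have "(x, y) \<in> edges (del_point A a) \<longleftrightarrow> (x, y) \<in> edges A"
      using that xa by (simp add: edges_del_point[OF d(1)])
    ultimately show ?thesis using graph_iso_adj[OF i, of x y] that xa by simp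
  qed
  have "nbrs (rim A x) a = nbrs A a \<inter> nbrs A x" using xa by (auto simp: rim_def)
  moreover have "f ` nbrs A a \<inter> nbrs G (f x) = f ` (nbrs A a \<inter> nbrs A x)"
  proof -
    have "f y \<in> nbrs G (f x) \<longleftrightarrow> y \<in> nbrs A x" if "y \<in> nbrs A a" for y
      using e[of y] subsetD[OF nb that] by simp
    then show ?thesis by blast
  qed
  ultimately show ?thesis
    unfolding punctured_def B using d xa U punctured_rim_iso[OF p xa(3,4)] by auto
qed

section \<open>Closed manifolds glued from punctured ones\<close>

text \<open>With \<open>S\<close> read as "being a sphere of a fixed dimension", this says that the
  connected sum of two spheres is a sphere: each loses a point, and the rims of the lost points are
  identified.\<close>

definition glue_closed :: "('a graph \<Rightarrow> bool) \<Rightarrow> bool" where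
  "glue_closed S \<longleftrightarrow> (\<forall>G U W A a f B b g. splits G U W \<longrightarrow> S A \<longrightarrow> S B
     \<longrightarrow> punctured A a f G U (U \<inter> W) \<longrightarrow> punctured B b g G W (U \<inter> W) \<longrightarrow> S G)"

definition iso_closed :: "('a graph \<Rightarrow> bool) \<Rightarrow> bool" where
  "iso_closed S \<longleftrightarrow> (\<forall>G H f. S G \<longrightarrow> graph_iso f G H \<longrightarrow> digital_space H \<longrightarrow> S H)"

text \<open>A point of \<open>U - W\<close> keeps its complete rim from \<open>A\<close>. At a point
  of \<open>U \<inter> W\<close> the rim is the connected sum of its rims in \<open>A\<close> and
  \<open>B\<close>, and \<open>glue_closed S\<close> applies. Points of \<open>W\<close> follow by
  exchanging the roles of the two sides.\<close>

lemma closed_manifold_glue_rim: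
  assumes S: "iso_closed S" "glue_closed S" and s: "splits G U W"
    and A: "closed_manifold_over S A" "punctured A a f G U (U \<inter> W)"
    and B: "closed_manifold_over S B" "punctured B b g G W (U \<inter> W)"
    and x: "x \<in> U"
  shows "S (rim G x)"
proof -
  have d: "digital_space G" and V: "verts G = U \<union> W" and E: "edges G \<subseteq> U \<times> U \<union> W \<times> W"
    using s by (auto simp: splits_def)
  obtain y where y: "y \<in> verts A" "y \<noteq> a" "x = f y"
    using punctured_image_verts[OF A(2)] x by auto
  have SA: "S (rim A y)" using A y by (auto simp: closed_manifold_over_def)
  show ?thesis
  proof (cases "x \<in> W")
    case False
    then have "y \<notin> nbrs A a" using punctured_mem[OF A(2) y(1,2)] y(3) x by auto
    moreover have "nbrs G (f y) \<subseteq> U" using E False y(3) by auto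
    ultimately have "graph_iso f (rim A y) (rim G x)"
      using punctured_rim_interior[OF A(2) y(1,2)] y(3) by simp
    then show ?thesis using S(1) SA d unfolding iso_closed_def by (meson digital_space_rim)
  next
    case True
    obtain z where z: "z \<in> verts B" "z \<noteq> b" "x = g z"
      using punctured_image_verts[OF B(2)] True by auto
    have SB: "S (rim B z)" using B z by (auto simp: closed_manifold_over_def)
    have "y \<in> nbrs A a" "z \<in> nbrs B b"
      using punctured_mem[OF A(2) y(1,2)] punctured_mem[OF B(2) z(1,2)] y(3) z(3) x True by auto
    then have p: "punctured (rim A y) a f (rim G x) (U \<inter> nbrs G x) (U \<inter> W \<inter> nbrs G x)"
      "punctured (rim B z) b g (rim G x) (W \<inter> nbrs G x) (U \<inter> W \<inter> nbrs G x)"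
      using punctured_rim_boundary[OF A(2), of y] punctured_rim_boundary[OF B(2), of z]
      unfolding y(3)[symmetric] z(3)[symmetric] by auto
    have "splits (rim G x) (U \<inter> nbrs G x) (W \<inter> nbrs G x)"
      using d V E by (auto simp: splits_def rim_def)
    moreover have "U \<inter> nbrs G x \<inter> (W \<inter> nbrs G x) = U \<inter> W \<inter> nbrs G x" by auto
    ultimately show ?thesis using S(2) SA SB p unfolding glue_closed_def by metis
  qed
qed

lemma closed_manifold_glue:
  assumes S: "iso_closed S" "glue_closed S" and s: "splits G U W"
    and A: "closed_manifold_over S A" "punctured A a f G U (U \<inter> W)" "connected_graph (induced G U)"
    and B: "closed_manifold_over S B" "punctured B b g G W (U \<inter> W)" "connected_graph (induced G W)"
    and ne: "U \<inter> W \<noteq> {}"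
  shows "closed_manifold_over S G"
proof -
  have d: "digital_space G" and V: "verts G = U \<union> W" using s by (auto simp: splits_def)
  obtain c where "c \<in> U \<inter> W" using ne by auto
  then have "connected_graph G" using V by (intro connected_graph_Un[OF d _ _ _ A(3) B(3), of c]) auto
  moreover have "S (rim G x)" if "x \<in> verts G" for x
  proof (cases "x \<in> U")
    case True
    then show ?thesis by (rule closed_manifold_glue_rim[OF S s A(1,2) B(1,2)])
  next
    case False
    then have "x \<in> W" using that V by auto
    then show ?thesis
      using closed_manifold_glue_rim[OF S splits_sym[OF s] B(1) _ A(1)] A(2) B(2)
      by (simp add: Int_commute)
  qed
  ultimately show ?thesis using d by (simp add: closed_manifold_over_def)
qed

text \<open>Removing \<open>v\<close> from both pieces keeps them contractible, because
  \<open>v\<close> is a boundary point whose rim in each piece is a punctured rim. The overlap also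
  becomes a punctured rim, so \<open>contractible_Un\<close> applies.\<close>

lemma contractible_glue_del_point:
  fixes A B G :: "'a::infinite graph"
  assumes s: "splits G U W"
    and A: "punctured A a f G U (U \<inter> W)" "contractible_graph (induced G U)"
    and B: "punctured B b g G W (U \<inter> W)" "contractible_graph (induced G W)"
    and rA: "\<And>x y. (x, y) \<in> edges A \<Longrightarrow> contractible_graph (del_point (rim A x) y)"
    and rB: "\<And>x y. (x, y) \<in> edges B \<Longrightarrow> contractible_graph (del_point (rim B x) y)"
    and v: "v \<in> U \<inter> W"
  shows "contractible_graph (del_point G v)"
proof -
  have d: "digital_space G" and V: "verts G = U \<union> W" and E: "edges G \<subseteq> U \<times> U \<union> W \<times> W"
    using s by (auto simp: splits_def)
  have one: "contractible_graph (induced G (X - {v}))"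
    if p: "punctured C c h G X (U \<inter> W)" and X: "contractible_graph (induced G X)" and vX: "v \<in> X"
      and r: "\<And>x y. (x, y) \<in> edges C \<Longrightarrow> contractible_graph (del_point (rim C x) y)"
    for C :: "'a graph" and c h X
  proof -
    have dC: "digital_space C" and XV: "X \<subseteq> verts G" using p by (auto simp: punctured_def)
    obtain y where y: "y \<in> verts C" "y \<noteq> c" "v = h y"
      using punctured_image_verts[OF p] vX by auto
    have yc: "(c, y) \<in> edges C" using punctured_mem[OF p y(1,2)] y(3) v by auto
    \<comment> \<open>Within \<open>X\<close> the rim of \<open>v\<close> is a copy of the rim of
      \<open>y\<close> in \<open>C\<close> without \<open>c\<close>, which is contractible, so
      \<open>v\<close> may be deleted from \<open>X\<close>.\<close>
    have "rim (induced G X) v = induced (rim G v) (X \<inter> nbrs G v)"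
      using vX by (simp add: rim_induced) (simp add: rim_def Int_ac)
    then have "graph_iso h (del_point (rim C y) c) (rim (induced G X) v)"
      using punctured_rim_iso[OF p y(1,2)] y(3) by simp
    then have "contractible_graph (rim (induced G X) v)"
      using contractible_iso r[OF digital_spaceD(3)[OF dC yc]] d by (metis digital_space_induced digital_space_rim)
    then have "contractible_graph (del_point (induced G X) v)"
      using X vX XV d by (intro contractible_del_point) auto
    then show ?thesis using d by (simp add: del_point_induced)
  qed
  \<comment> \<open>The overlap is a copy of the rim of \<open>a\<close>; losing \<open>v\<close>
    corresponds to removing its preimage \<open>y\<close>.\<close>
  have "contractible_graph (induced G (U \<inter> W - {v}))"
  proof -
    have dA: "digital_space A" and aA: "a \<in> verts A" and i: "graph_iso f (del_point A a) (induced G U)"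
      and Bd: "U \<inter> W = f ` nbrs A a" using A(1) by (auto simp: punctured_def)
    obtain y where y: "y \<in> nbrs A a" "v = f y" using Bd v by auto
    have nb: "nbrs A a \<subseteq> verts A - {a}"
      using digital_spaceD(2)[OF dA] digital_spaceD(4)[OF dA, of a a] by auto
    have "f ` (nbrs A a - {y}) = U \<inter> W - {v}"
    proof -
      have "f x = v \<longleftrightarrow> x = y" if "x \<in> nbrs A a" for x
        using graph_iso_eq_iff[OF i, of x y] y(2) subsetD[OF nb that] subsetD[OF nb y(1)] by simp
      then show ?thesis unfolding Bd by blast
    qed
    then have "graph_iso f (induced (del_point A a) (nbrs A a - {y})) (induced (induced G U) (U \<inter> W - {v}))"
      using nb by (intro graph_iso_induced[OF i]) auto
    moreover have "induced (del_point A a) (nbrs A a - {y}) = del_point (rim A a) y"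
      unfolding rim_def del_point_induced[OF dA] unfolding del_point_def induced_induced
      using nb by (intro induced_cong[OF dA]) auto
    moreover have "induced (induced G U) (U \<inter> W - {v}) = induced G (U \<inter> W - {v})"
      unfolding induced_induced by (rule induced_cong[OF d]) auto
    ultimately show ?thesis using contractible_iso rA[of a y] y d by (metis digital_space_induced mem_nbrs)
  qed
  moreover have "splits (del_point G v) (U - {v}) (W - {v})"
    using d V E by (auto simp: splits_def edges_del_point)
  moreover have "induced (del_point G v) (X - {v}) = induced G (X - {v})" for X
    unfolding del_point_def induced_induced by (rule induced_cong[OF d]) auto
  moreover have "(U - {v}) \<inter> (W - {v}) = U \<inter> W - {v}" by auto
  ultimately show ?thesis
    using one[OF A IntD1[OF v] rA] one[OF B IntD2[OF v] rB] by (simp add: contractible_Un[of "del_point G v" "U - {v}" "W - {v}"])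
qed

section \<open>Circles\<close>

lemma connected_graph_boundary_edge:
  assumes "connected_graph G" "X \<subseteq> verts G" "X \<noteq> {}" "X \<noteq> verts G"
  obtains p q where "(p, q) \<in> edges G" "p \<in> X" "q \<notin> X"
proof -
  obtain x y where "x \<in> X" "y \<in> verts G" "y \<notin> X" using assms by auto
  then have "(x, y) \<in> (edges G)\<^sup>*" using assms by (auto simp: connected_graph_def)
  then have "y \<notin> X \<longrightarrow> (\<exists>p q. (p, q) \<in> edges G \<and> p \<in> X \<and> q \<notin> X)"
    by induction (use \<open>x \<in> X\<close> in blast)+
  then show thesis using that \<open>y \<notin> X\<close> by blast
qed

lemma zero_sphere_nbrs:
  assumes "digital_space G" "zero_sphere (rim G x)" "w \<in> nbrs G x"
  obtains y where "nbrs G x = {w, y}" "y \<noteq> w"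
proof -
  obtain a b where ab: "a \<noteq> b" "rim G x = Graph {a, b} {}" using assms(2) by (auto simp: zero_sphere_def)
  have "nbrs G x = verts (rim G x)" using digital_spaceD(2)[OF assms(1)] by auto
  then have "nbrs G x = {a, b}" using ab by simp
  then show thesis using that ab(1) assms(3) by (cases "w = a") (auto simp: insert_commute)
qed

text \<open>An arc \<open>W\<close> of the cycle \<open>S\<close> is left by at most two edges; extending it by an outer neighbour
  of one of its ends preserves this as long as at least two points remain.\<close>

lemma one_sphere_grow_arc:
  fixes S :: "'a::infinite graph"
  assumes S: "one_sphere S" and W: "W \<subseteq> verts S" "contractible_graph (induced S W)"
    and out: "card {(u, z) \<in> edges S. u \<in> W \<and> z \<notin> W} \<le> 2" and two: "card (verts S - W) \<ge> 2"
  obtains x where "x \<in> verts S - W" "contractible_graph (induced S (insert x W))"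
    "card {(u, z) \<in> edges S. u \<in> insert x W \<and> z \<notin> insert x W} \<le> 2"
proof -
  have d: "digital_space S" and fin: "finite (verts S)" and con: "connected_graph S"
    and zs: "\<And>v. v \<in> verts S \<Longrightarrow> zero_sphere (rim S v)" using S by (auto simp: one_sphere_def)
  have finE: "finite (edges S)"
    using d fin by (auto simp: digital_space_def intro: finite_subset)
  \<comment> \<open>Only pairs directed out of \<open>X\<close> are collected, so each undirected
    edge leaving \<open>X\<close> counts once.\<close>
  let ?O = "\<lambda>X. {(u, z) \<in> edges S. u \<in> X \<and> z \<notin> X}"
  have finO: "finite (?O X)" for X by (rule finite_subset[OF _ finE]) auto
  have "W \<noteq> {}" using contractible_connected(1)[OF W(2)] by (auto simp: connected_graph_def)
  moreover have "W \<noteq> verts S" using two by auto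
  ultimately obtain w x where wx: "(w, x) \<in> edges S" "w \<in> W" "x \<notin> W"
    using connected_graph_boundary_edge[OF con W(1)] by blast
  have x: "x \<in> verts S" "(x, w) \<in> edges S" using digital_spaceD[OF d wx(1)] by auto
  then obtain y where y: "nbrs S x = {w, y}" "y \<noteq> w" using zero_sphere_nbrs[OF d zs[OF x(1)], of w] by auto
  have "y \<in> nbrs S x" using y(1) by simp
  then have xy: "(x, y) \<in> edges S" by simp
  have nx: "z = w \<or> z = y" if "(x, z) \<in> edges S" for z 
  proof -
    have "z \<in> nbrs S x" using that by simp
    then show ?thesis unfolding y(1) by simp
  qed
  \<comment> \<open>Were both neighbours of \<open>x\<close> in \<open>W\<close>, the two edges at
    \<open>x\<close> would be all that leaves \<open>W\<close>, and nothing would leave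
    \<open>insert x W\<close>, although a further point lies outside.\<close>
  have "y \<notin> W"
  proof
    assume yW: "y \<in> W"
    have yx: "(y, x) \<in> edges S" using digital_spaceD(3)[OF d xy] .
    have "{(w, x), (y, x)} \<subseteq> ?O W" "card {(w, x), (y, x)} = 2" using wx yx yW y(2) by auto
    then have O: "?O W = {(w, x), (y, x)}" using card_seteq[OF finO[of W], of "{(w, x), (y, x)}"] out by simp
    have "insert x W \<noteq> verts S"
    proof
      assume "insert x W = verts S"
      then have "verts S - W \<subseteq> {x}" by auto
      then have "card (verts S - W) \<le> card {x}" by (intro card_mono) auto
      then show False using two by simp
    qed
    then obtain p q where pq: "(p, q) \<in> edges S" "p \<in> insert x W" "q \<notin> insert x W"
      using connected_graph_boundary_edge[OF con, of "insert x W"] W(1) x(1) by blast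
    then have "p \<noteq> x" using nx[of q] wx(2) yW by auto
    then have "(p, q) \<in> ?O W" using pq by auto
    then show False using O pq(3) by auto
  qed
  show thesis
  proof (rule that)
    show "x \<in> verts S - W" using x wx by auto
    show "contractible_graph (induced S (insert x W))"
    proof (rule contractible_del_pointI[where x = x])
      have "rim (induced S (insert x W)) x = induced S (insert x W \<inter> nbrs S x)" by (rule rim_induced) simp
      also have "\<dots> = induced S {w}"
        using y(1) wx \<open>y \<notin> W\<close> digital_spaceD(4)[OF d xy] by (intro arg_cong[where f = "induced S"]) auto
      finally show "contractible_graph (rim (induced S (insert x W)) x)"
        using contractible_singleton[of "induced S {w}" w] d W(1) wx(2) by auto
      show "contractible_graph (del_point (induced S (insert x W)) x)"
        using W(2) wx(3) by (simp add: del_point_induced[OF d])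
    qed (use d x in auto)
    \<comment> \<open>The edge from \<open>w\<close> to \<open>x\<close> no longer leaves the arc
      and the one from \<open>x\<close> to \<open>y\<close> takes its place.\<close>
    have "?O (insert x W) \<subseteq> insert (x, y) (?O W - {(w, x)})" using nx wx by auto
    then have "card (?O (insert x W)) \<le> card (insert (x, y) (?O W - {(w, x)}))"
      by (intro card_mono) (use finO in auto)
    also have "\<dots> \<le> Suc (card (?O W - {(w, x)}))" by (simp add: card_insert_if finO)
    also have "\<dots> = card (?O W)" using wx by (intro card_Suc_Diff1 finO) auto
    finally show "card (?O (insert x W)) \<le> 2" using out by linarith
  qed
qed

text \<open>A contractible arc is grown from a single point until it misses exactly one point of the
  circle; that point is the \<open>v\<close> sought.\<close>

lemma one_sphere_contractible_del_point:
  fixes S :: "'a::infinite graph"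
  assumes S: "one_sphere S"
  shows "\<exists>v\<in>verts S. contractible_graph (del_point S v)"
proof -
  have d: "digital_space S" and fin: "finite (verts S)" and con: "connected_graph S"
    and zs: "\<And>v. v \<in> verts S \<Longrightarrow> zero_sphere (rim S v)" using S by (auto simp: one_sphere_def)
  let ?O = "\<lambda>X. {(u, z) \<in> edges S. u \<in> X \<and> z \<notin> X}"
  obtain w where w: "w \<in> verts S" using con by (auto simp: connected_graph_def)
  obtain a b where ab: "a \<noteq> b" "rim S w = Graph {a, b} {}" using zs[OF w] by (auto simp: zero_sphere_def)
  have nw: "nbrs S w = {a, b}"
  proof -
    have "nbrs S w = verts (rim S w)" using digital_spaceD(2)[OF d] by auto
    then show ?thesis using ab by simp
  qed
  \<comment> \<open>The strict bound ensures that at least two points lie outside the arc whenever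
    it has to grow.\<close>
  have arc: "\<exists>W\<subseteq>verts S. card W = Suc k \<and> contractible_graph (induced S W) \<and> card (?O W) \<le> 2"
    if "Suc k < card (verts S)" for k
    using that
  proof (induction k)
    case 0
    have "?O {w} = Pair w ` nbrs S w" using digital_spaceD(4)[OF d, of w w] by auto
    then have "card (?O {w}) \<le> card (nbrs S w)" using nw card_image_le[of "nbrs S w" "Pair w"] by simp
    also have "\<dots> \<le> 2" using nw ab(1) by simp
    finally have "card (?O {w}) \<le> 2" .
    moreover have "contractible_graph (induced S {w})"
      using w d by (intro contractible_singleton[of _ w]) auto
    ultimately show ?case using w by (intro exI[of _ "{w}"]) auto
  next
    case (Suc k)
    then obtain W where W: "W \<subseteq> verts S" "card W = Suc k" "contractible_graph (induced S W)" "card (?O W) \<le> 2"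
      by auto
    have "card (verts S - W) \<ge> 2"
      using Suc.prems W card_Diff_subset[of W "verts S"] finite_subset[OF W(1) fin] by simp
    then obtain x where "x \<in> verts S - W" "contractible_graph (induced S (insert x W))" "card (?O (insert x W)) \<le> 2"
      using one_sphere_grow_arc[OF S W(1,3,4)] by blast
    moreover from this have "card (insert x W) = Suc (Suc k)" using W finite_subset[OF W(1) fin] by simp
    ultimately show ?case using W(1) by (intro exI[of _ "insert x W"]) auto
  qed
  have "a \<in> verts S" "b \<in> verts S" 
    using nw digital_spaceD(2)[OF d, of w a] digital_spaceD(2)[OF d, of w b]
    unfolding mem_nbrs[symmetric] by simp_all
  then have "card {a, b} \<le> card (verts S)" using fin by (intro card_mono) auto
  then have c2: "card (verts S) \<ge> 2" using ab(1) by simp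
  then obtain k where k: "card (verts S) = Suc (Suc k)" by (metis Suc_le_D numeral_2_eq_2 Suc_le_mono)
  then obtain W where W: "W \<subseteq> verts S" "card W = Suc k" "contractible_graph (induced S W)"
    using arc[of k] by auto
  have "card (verts S - W) = 1"
    using k W card_Diff_subset[of W "verts S"] finite_subset[OF W(1) fin] by simp
  then obtain x where x: "verts S - W = {x}" by (rule card_1_singletonE)
  then have "verts S - {x} = W" using W(1) by auto
  then show ?thesis using W(3) x unfolding del_point_def by auto
qed

section \<open>Spheres as unions of disks\<close>

text \<open>Transports the tagged sum into \<open>G\<close>, with \<open>U\<close> and
  \<open>W\<close> the images of the two summands. Since \<open>k\<close> is an isomorphism of the
  boundaries, an edge of \<open>C\<close> between boundary points adds nothing new to the copy of
  \<open>D\<close>, and conversely, so both copies are induced subspaces.\<close>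

lemma amalgam_splits:
  fixes D :: "'a graph" and C :: "'b graph" and G :: "'c graph"
  assumes d: "digital_space D" "digital_space C" "digital_space G"
    and BD: "BD \<subseteq> verts D" and BC: "BC \<subseteq> verts C"
    and k: "graph_iso k (induced C BC) (induced D BD)" and h: "graph_iso h (amalgam D C BC k) G"
  obtains U W f g where "splits G U W" "graph_iso f D (induced G U)" "graph_iso g C (induced G W)"
    "U \<inter> W = f ` BD" "U \<inter> W = g ` BC"
proof -
  let ?A = "amalgam D C BC k"
  \<comment> \<open>The embedding of \<open>C\<close> into the sum: boundary points go to their
    partners in \<open>D\<close>.\<close>
  define c where "c = (\<lambda>y. if y \<in> BC then Inl (k y) else (Inr y :: 'a + 'b))"
  have VA: "verts ?A = Inl ` verts D \<union> c ` verts C"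
    and EA: "edges ?A = map_prod Inl Inl ` edges D \<union> map_prod c c ` edges C"
    by (simp_all add: amalgam_def map_graph_def c_def[symmetric] Let_def)
  have kB: "k ` BC = BD" using graph_iso_verts[OF k] BD BC by (simp add: Int_absorb1)
  have kinj: "k x = k y \<longleftrightarrow> x = y" if "x \<in> BC" "y \<in> BC" for x y
    using graph_iso_eq_iff[OF k, of x y] that BC by auto
  have kadj: "(k x, k y) \<in> edges D \<longleftrightarrow> (x, y) \<in> edges C" if "x \<in> BC" "y \<in> BC" for x y
    using graph_iso_adj[OF k, of x y] that BC kB by auto
  have cinj: "c x = c y \<longleftrightarrow> x = y" for x y using kinj by (auto simp: c_def)
  have cl: "c y = Inl x \<longleftrightarrow> y \<in> BC \<and> x = k y" for x y by (auto simp: c_def)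
  have adjD: "(Inl x, Inl y) \<in> edges ?A \<longleftrightarrow> (x, y) \<in> edges D" for x y
  proof
    assume "(Inl x, Inl y) \<in> edges ?A"
    then consider "(x, y) \<in> edges D" | u v where "(u, v) \<in> edges C" "c u = Inl x" "c v = Inl y"
      unfolding EA by (auto simp: map_prod_def)
    then show "(x, y) \<in> edges D" by cases (auto simp: cl kadj)
  qed (auto simp: EA)
  have adjC: "(c x, c y) \<in> edges ?A \<longleftrightarrow> (x, y) \<in> edges C" for x y
  proof
    assume "(c x, c y) \<in> edges ?A"
    then consider u v where "(u, v) \<in> edges D" "c x = Inl u" "c y = Inl v"
      | u v where "(u, v) \<in> edges C" "c u = c x" "c v = c y"
      unfolding EA by (auto simp: map_prod_def)
    then show "(x, y) \<in> edges C" by cases (auto simp: cl kadj cinj)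
  qed (auto simp: EA)
  have iD: "graph_iso Inl D (induced ?A (Inl ` verts D))"
    unfolding graph_iso_def bij_betw_def using VA by (auto simp: adjD)
  have iC: "graph_iso c C (induced ?A (c ` verts C))"
    unfolding graph_iso_def bij_betw_def using VA by (auto simp: adjC cinj inj_on_def)
  define U W where "U = h ` Inl ` verts D" and "W = h ` c ` verts C"
  have VG: "verts G = U \<union> W" using graph_iso_verts[OF h] by (simp add: U_def W_def VA image_Un)
  have hD: "graph_iso h (induced ?A (Inl ` verts D)) (induced G U)"
    and hC: "graph_iso h (induced ?A (c ` verts C)) (induced G W)"
    using h VA by (auto intro!: graph_iso_induced simp: U_def W_def)
  have "edges G \<subseteq> U \<times> U \<union> W \<times> W"
  proof (rule subrelI)
    fix x y assume e: "(x, y) \<in> edges G"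
    obtain x' y' where xy: "x' \<in> verts ?A" "y' \<in> verts ?A" "x = h x'" "y = h y'"
      using digital_spaceD(1,2)[OF d(3) e] graph_iso_verts[OF h] by auto
    then have "(x', y') \<in> edges ?A" using graph_iso_adj[OF h] e by auto
    then show "(x, y) \<in> U \<times> U \<union> W \<times> W"
      using digital_spaceD(1,2)[OF d(1)] digital_spaceD(1,2)[OF d(2)] xy
      unfolding EA by (auto simp: U_def W_def)
  qed
  then have s: "splits G U W" using d(3) VG by (auto simp: splits_def)
  have "U \<inter> W = h ` (Inl ` verts D \<inter> c ` verts C)"
    using h unfolding U_def W_def graph_iso_def bij_betw_def
    by (intro inj_on_image_Int[symmetric]) (auto simp: VA)
  moreover have "Inl ` verts D \<inter> c ` verts C = c ` BC"
    using kB BD BC by (auto simp: c_def split: if_splits)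
  moreover have "c ` BC = Inl ` BD" using kB by (auto simp: c_def image_iff)
  ultimately have "U \<inter> W = (h \<circ> Inl) ` BD" "U \<inter> W = (h \<circ> c) ` BC"
    by (simp_all only: image_comp[symmetric])
  then show thesis
    using that[OF s graph_iso_comp[OF iD hD] graph_iso_comp[OF iC hC]] by simp
qed

text \<open>Forgetting the tags is the isomorphism. Its inverse \<open>t\<close> tags the points of
  \<open>U\<close> with \<open>Inl\<close> and the rest with \<open>Inr\<close>; on \<open>W\<close>
  it agrees with the embedding used by \<open>amalgam\<close>.\<close>

lemma splits_amalgam:
  assumes s: "splits G U W"
  shows "graph_iso (case_sum id id) (amalgam (induced G U) (induced G W) (U \<inter> W) id) G"
proof -
  have d: "digital_space G" and V: "verts G = U \<union> W" and E: "edges G \<subseteq> U \<times> U \<union> W \<times> W"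
    using s by (auto simp: splits_def)
  let ?A = "amalgam (induced G U) (induced G W) (U \<inter> W) id"
  define c :: "'a \<Rightarrow> 'a + 'a" where "c = (\<lambda>y. if y \<in> U \<inter> W then Inl (id y) else Inr y)"
  define t :: "'a \<Rightarrow> 'a + 'a" where "t = (\<lambda>y. if y \<in> U then Inl y else Inr y)"
  have tc: "t y = c y" if "y \<in> W" for y using that by (auto simp: t_def c_def)
  have tU: "t y = Inl y" if "y \<in> U" for y using that by (auto simp: t_def)
  have "verts ?A = Inl ` (verts G \<inter> U) \<union> c ` (verts G \<inter> W)"
    and EA: "edges ?A = map_prod Inl Inl ` (edges G \<inter> U \<times> U) \<union> map_prod c c ` (edges G \<inter> W \<times> W)"
    unfolding c_def by (simp_all add: amalgam_def map_graph_def Let_def)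
  then have VA: "verts ?A = t ` U \<union> t ` W" using V tc tU by (simp add: Int_absorb1)
  have EA': "edges ?A = map_prod t t ` edges G"
  proof -
    have "map_prod Inl Inl ` (edges G \<inter> U \<times> U) = map_prod t t ` (edges G \<inter> U \<times> U)"
      by (rule image_cong) (auto simp: tU)
    moreover have "map_prod c c ` (edges G \<inter> W \<times> W) = map_prod t t ` (edges G \<inter> W \<times> W)"
      by (rule image_cong) (auto simp: tc)
    moreover have "edges G = (edges G \<inter> U \<times> U) \<union> (edges G \<inter> W \<times> W)" using E by auto
    ultimately show ?thesis unfolding EA by (metis image_Un)
  qed
  have ht: "case_sum id id (t y) = y" for y by (simp add: t_def)
  have tinj: "t x = t y \<longleftrightarrow> x = y" for x y using ht by metis
  have "bij_betw (case_sum id id) (verts ?A) (verts G)"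
    unfolding VA V by (rule bij_betw_byWitness[where f' = t]) (auto simp: ht)
  moreover have "(t x, t y) \<in> edges ?A \<longleftrightarrow> (x, y) \<in> edges G" for x y
    unfolding EA' by (auto simp: tinj map_prod_def)
  ultimately show ?thesis
    unfolding graph_iso_def VA by (auto simp: ht)
qed

lemma graph_iso_id [simp]: "graph_iso id G G" "graph_iso (\<lambda>x. x) G G"
  by (simp_all add: graph_iso_def id_def[symmetric])

lemma punctured_comp:
  assumes M: "closed_manifold_over S M" "v \<in> verts M" and G: "digital_space G" "U \<subseteq> verts G"
    and p: "graph_iso p (del_point M v) D" and f: "graph_iso f D (induced G U)"
    and B: "B = f ` p ` nbrs M v"
  shows "punctured M v (f \<circ> p) G U B"
  using assms graph_iso_comp[OF p f] by (simp add: punctured_def closed_manifold_over_def image_comp)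

lemma disk_over_subset:
  assumes "disk_over S D B" shows "B \<subseteq> verts D"
proof -
  obtain M v p where M: "closed_manifold_over S M" "graph_iso p (del_point M v) D" "B = p ` nbrs M v"
    using assms by (auto simp: disk_over_def bounded_manifold_over_def)
  then have "digital_space M" by (simp add: closed_manifold_over_def)
  then have "nbrs M v \<subseteq> verts (del_point M v)"
    using digital_spaceD(2)[of M v] digital_spaceD(4)[of M v v] by auto
  then show ?thesis using graph_iso_verts[OF M(2)] M(3) by auto
qed

lemma disk_over_punctured:
  fixes D G :: "'a::infinite graph"
  assumes D: "disk_over S D B" and G: "digital_space G" "U \<subseteq> verts G" and f: "graph_iso f D (induced G U)"
  shows "\<exists>(A :: 'a graph) a h. closed_manifold_over S A \<and> punctured A a h G U (f ` B)"
    and "contractible_graph (induced G U)"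
proof -
  obtain M v p where M: "closed_manifold_over S M" "v \<in> verts M" "graph_iso p (del_point M v) D"
    and B: "B = p ` nbrs M v"
    using D by (auto simp: disk_over_def bounded_manifold_over_def)
  show "\<exists>(A :: 'a graph) a h. closed_manifold_over S A \<and> punctured A a h G U (f ` B)"
    using punctured_comp[OF M(1,2) G M(3) f refl] M(1) unfolding B by (intro exI conjI)
  show "contractible_graph (induced G U)"
    using D f G by (auto simp: disk_over_def intro: contractible_iso)
qed

lemma punctured_disk_over:
  fixes A G :: "'a graph"
  assumes A: "closed_manifold_over S A" "punctured A a f G U B" and c: "contractible_graph (induced G U)"
  shows "disk_over S (induced G U) B"
proof -
  have "connected_graph (induced G U)" "digital_space (induced G U)"
    using c contractible_connected(1) contractible_digital_finite(1) by auto
  moreover have "a \<in> verts A" "graph_iso f (del_point A a) (induced G U)" "B = f ` nbrs A a"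
    using A(2) by (simp_all add: punctured_def)
  ultimately show ?thesis using c A(1) by (auto simp: disk_over_def bounded_manifold_over_def)
qed

text \<open>Together with \<open>digital_sphere_Suc_SucI\<close> this replaces the definition in the
  gluing arguments: a sphere is a space split into two contractible punctured closed manifolds that
  meet exactly in their boundaries.\<close>

lemma digital_sphere_Suc_SucE:
  fixes G :: "'a::infinite graph"
  assumes "digital_sphere (Suc (Suc n)) G"
  obtains U W a f b g and A B :: "'a graph" where "splits G U W"
    "closed_manifold_over (digital_sphere (Suc n)) A" "punctured A a f G U (U \<inter> W)"
    "closed_manifold_over (digital_sphere (Suc n)) B" "punctured B b g G W (U \<inter> W)"
    "contractible_graph (induced G U)" "contractible_graph (induced G W)"
proof -
  obtain D C :: "'a graph" and BD BC k h where d: "digital_space G" and D: "disk_over (digital_sphere (Suc n)) D BD"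
    and C: "disk_over (digital_sphere (Suc n)) C BC"
    and k: "graph_iso k (induced C BC) (induced D BD)" and h: "graph_iso h (amalgam D C BC k) G"
    using assms by auto
  have "digital_space D" "digital_space C" using D C by (auto simp: disk_over_def bounded_manifold_over_def)
  then obtain U W f g where s: "splits G U W" and f: "graph_iso f D (induced G U)"
    and g: "graph_iso g C (induced G W)" and UW: "U \<inter> W = f ` BD" "U \<inter> W = g ` BC"
    using amalgam_splits[OF _ _ d disk_over_subset[OF D] disk_over_subset[OF C] k h] by metis
  have UV: "U \<subseteq> verts G" "W \<subseteq> verts G" using s by (auto simp: splits_def)
  obtain A :: "'a graph" and a f' where A: "closed_manifold_over (digital_sphere (Suc n)) A" "punctured A a f' G U (U \<inter> W)"
    using disk_over_punctured(1)[OF D d UV(1) f] unfolding UW(1) by blast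
  obtain B :: "'a graph" and b g' where B: "closed_manifold_over (digital_sphere (Suc n)) B" "punctured B b g' G W (U \<inter> W)"
    using disk_over_punctured(1)[OF C d UV(2) g] unfolding UW(2) by blast
  show thesis
    by (rule that[OF s A B disk_over_punctured(2)[OF D d UV(1) f] disk_over_punctured(2)[OF C d UV(2) g]])
qed

lemma digital_sphere_Suc_SucI:
  fixes A B G :: "'a graph"
  assumes s: "splits G U W"
    and A: "closed_manifold_over (digital_sphere (Suc n)) A" "punctured A a f G U (U \<inter> W)"
    and B: "closed_manifold_over (digital_sphere (Suc n)) B" "punctured B b g G W (U \<inter> W)"
    and c: "contractible_graph (induced G U)" "contractible_graph (induced G W)"
  shows "digital_sphere (Suc (Suc n)) G"
proof -
  have "induced (induced G W) (U \<inter> W) = induced (induced G U) (U \<inter> W)"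
    unfolding induced_induced by (auto simp: induced_def)
  then have "graph_iso id (induced (induced G W) (U \<inter> W)) (induced (induced G U) (U \<inter> W))" by simp
  moreover have "digital_space G" using s by (simp add: splits_def)
  ultimately show ?thesis
    using splits_amalgam[OF s] punctured_disk_over[OF A c(1)] punctured_disk_over[OF B c(2)]
    by (simp only: digital_sphere.simps) blast
qed

section \<open>Invariance of spheres under isomorphism, and spheres of dimension zero and
  one\<close>

lemma digital_sphere_digital_space: "digital_sphere n G \<Longrightarrow> digital_space G"
proof -
  assume G: "digital_sphere n G"
  consider "n = 0" | "n = Suc 0" | m where "n = Suc (Suc m)" by (metis not0_implies_Suc)
  then show ?thesis
  proof cases
    case 1
    then show ?thesis using G by (auto simp: zero_sphere_def intro!: digital_space_finiteI)
  qed (use G in \<open>auto simp: one_sphere_def\<close>)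
qed

lemma zero_sphere_iso:
  assumes "zero_sphere G" "graph_iso f G H" "digital_space H"
  shows "zero_sphere H"
proof -
  obtain a b where ab: "a \<noteq> b" "G = Graph {a, b} {}" using assms(1) by (auto simp: zero_sphere_def)
  have V: "verts H = {f a, f b}" using graph_iso_verts[OF assms(2)] ab by simp
  have "f a \<noteq> f b" using graph_iso_eq_iff[OF assms(2), of a b] ab by simp
  moreover have "edges H = {}"
  proof -
    have False if e: "(x, y) \<in> edges H" for x y
    proof -
      obtain x' y' where "x' \<in> verts G" "y' \<in> verts G" "x = f x'" "y = f y'"
        using digital_spaceD(1,2)[OF assms(3) e] graph_iso_verts[OF assms(2)] by auto
      then show False using graph_iso_adj[OF assms(2)] e ab(2) by auto
    qed
    then show ?thesis by auto
  qed
  ultimately show ?thesis using V unfolding zero_sphere_def by (cases H) auto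
qed

lemma one_sphere_iso:
  assumes "one_sphere G" "graph_iso f G H" "digital_space H"
  shows "one_sphere H"
proof -
  have d: "digital_space G" using assms(1) by (simp add: one_sphere_def)
  have V: "verts H = f ` verts G" by (rule graph_iso_verts[OF assms(2)])
  have "connected_graph H"
  proof (rule connected_graph_image[OF _ V])
    show "connected_graph G" using assms(1) by (simp add: one_sphere_def)
    show "(f x, f y) \<in> (edges H)\<^sup>*" if "(x, y) \<in> edges G" for x y
      using graph_iso_adj[OF assms(2), of x y] digital_spaceD(1,2)[OF d that] that by auto
  qed
  moreover have "zero_sphere (rim H (f v))" if "v \<in> verts G" for v
    using zero_sphere_iso[OF _ graph_iso_rim[OF assms(2) d assms(3) that]] assms(1,3) that
    by (simp add: one_sphere_def)
  ultimately show ?thesis using assms V unfolding one_sphere_def by auto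
qed

text \<open>From dimension two on the definition is already up to an isomorphism \<open>h\<close>,
  which can be composed with the given one. Only dimensions zero and one need an argument.\<close>

lemma iso_closed_digital_sphere: "iso_closed (digital_sphere n :: 'a graph \<Rightarrow> bool)"
  unfolding iso_closed_def
proof (intro allI impI)
  fix G H :: "'a graph" and f
  assume G: "digital_sphere n G" and i: "graph_iso f G H" and d: "digital_space H"
  consider "n = 0" | "n = Suc 0" | m where "n = Suc (Suc m)" by (metis not0_implies_Suc)
  then show "digital_sphere n H"
  proof cases
    case 3
    then show ?thesis using G d graph_iso_comp[OF _ i] by (simp only: digital_sphere.simps) blast
  qed (use G i d zero_sphere_iso one_sphere_iso in auto)
qed

text \<open>Brings circles into the scheme of closed manifolds. Finiteness has to be kept apart,
  since the two-way infinite path is also a closed manifold over 0-spheres.\<close>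

lemma one_sphere_iff: "one_sphere G \<longleftrightarrow> closed_manifold_over zero_sphere G \<and> finite (verts G)"
  by (auto simp: one_sphere_def closed_manifold_over_def)

text \<open>A 0-sphere minus a point is a single point with empty boundary, so the two pieces are
  distinct points without an edge between them.\<close>

lemma glue_closed_zero_sphere: "glue_closed (zero_sphere :: 'a graph \<Rightarrow> bool)"
  unfolding glue_closed_def
proof (intro allI impI)
  fix G A B :: "'a graph" and U W a f b g
  assume s: "splits G U W" and zs: "zero_sphere A" "zero_sphere B"
    and p: "punctured A a f G U (U \<inter> W)" "punctured B b g G W (U \<inter> W)"
  have one: "\<exists>c. X = {c} \<and> nbrs C z = {}"
    if C: "zero_sphere C" "punctured C z h G X Y" for C :: "'a graph" and z h X Y
  proof -
    obtain x y where xy: "x \<noteq> y" "C = Graph {x, y} {}" using C(1) by (auto simp: zero_sphere_def)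
    have "z \<in> {x, y}" using C(2) xy by (simp add: punctured_def)
    then show ?thesis using punctured_image_verts[OF C(2)] xy by (auto simp: nbrs_def)
  qed
  obtain c where c: "U = {c}" "nbrs A a = {}" using one[OF zs(1) p(1)] by auto
  obtain e where e: "W = {e}" using one[OF zs(2) p(2)] by auto
  have "U \<inter> W = {}" using p(1) c(2) by (simp add: punctured_def)
  then have "c \<noteq> e" using c e by auto
  moreover have "edges G = {}"
    using s c e digital_spaceD(4)[of G] unfolding splits_def by fastforce
  moreover have "verts G = {c, e}" using s c e by (auto simp: splits_def)
  ultimately show "zero_sphere G" unfolding zero_sphere_def by (cases G) auto
qed

section \<open>The induction on the dimension of spheres\<close>

lemma punctured_contractible:
  fixes f :: "'a \<Rightarrow> 'b::infinite"
  assumes "punctured A a f G U B" "contractible_graph (del_point A a)"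
  shows "contractible_graph (induced G U)"
  using assms by (auto simp: punctured_def intro: contractible_iso)

lemma closed_manifold_del_point_all:
  fixes M :: "'a graph"
  assumes M: "closed_manifold_over S M"
    and S: "\<And>(T :: 'a graph) v. S T \<Longrightarrow> v \<in> verts T \<Longrightarrow> contractible_graph (del_point T v)"
    and v: "v \<in> verts M" "contractible_graph (del_point M v)" and x: "x \<in> verts M"
  shows "contractible_graph (del_point M x)"
proof (rule contractible_del_point_all[OF _ _ _ v x])
  show d: "digital_space M" and "connected_graph M" using M by (auto simp: closed_manifold_over_def)
  show "contractible_graph (del_point (rim M y) z)" if "(y, z) \<in> edges M" for y z
    using M digital_spaceD[OF d that] that by (intro S) (auto simp: closed_manifold_over_def)
qed

text \<open>One step of the induction: the hypotheses are what is known about spheres of dimension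
  \<open>Suc n\<close>, and they are applied to the rims in the closed manifolds behind the two
  disks.\<close>

lemma digital_sphere_Suc_Suc_closed:
  fixes G :: "'a::infinite graph"
  assumes S: "\<And>(T :: 'a graph) v. digital_sphere (Suc n) T \<Longrightarrow> v \<in> verts T \<Longrightarrow> contractible_graph (del_point T v)"
    and ne: "\<And>T :: 'a graph. digital_sphere (Suc n) T \<Longrightarrow> verts T \<noteq> {}"
    and glue: "glue_closed (digital_sphere (Suc n) :: 'a graph \<Rightarrow> bool)"
    and G: "digital_sphere (Suc (Suc n)) G"
  shows "closed_manifold_over (digital_sphere (Suc n)) G"
    and "\<exists>v\<in>verts G. contractible_graph (del_point G v)"
proof -
  obtain U W a f b g and A B :: "'a graph" where s: "splits G U W"
    and A: "closed_manifold_over (digital_sphere (Suc n)) A" "punctured A a f G U (U \<inter> W)"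
    and B: "closed_manifold_over (digital_sphere (Suc n)) B" "punctured B b g G W (U \<inter> W)"
    and c: "contractible_graph (induced G U)" "contractible_graph (induced G W)"
    using digital_sphere_Suc_SucE[OF G] .
  have rim: "contractible_graph (del_point (rim C x) y)"
    if C: "closed_manifold_over (digital_sphere (Suc n)) C" and e: "(x, y) \<in> edges C" for C :: "'a graph" and x y
  proof -
    have "digital_space C" using C by (simp add: closed_manifold_over_def)
    then show ?thesis
      using C e digital_spaceD[of C x y] by (intro S) (auto simp: closed_manifold_over_def)
  qed
  \<comment> \<open>The rim of \<open>a\<close> is a sphere and so nonempty, which yields a common
    boundary point \<open>v\<close> at which to puncture \<open>G\<close>.\<close>
  have "a \<in> verts A" and UW: "U \<inter> W = f ` nbrs A a" using A(2) by (auto simp: punctured_def)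
  then have "verts (rim A a) \<noteq> {}" using A(1) by (intro ne) (auto simp: closed_manifold_over_def)
  then obtain v where v: "v \<in> U \<inter> W" using UW by auto
  show "closed_manifold_over (digital_sphere (Suc n)) G"
    using closed_manifold_glue[OF iso_closed_digital_sphere glue s A _ B] contractible_connected(1) c v by auto
  have "contractible_graph (del_point G v)"
    by (rule contractible_glue_del_point[OF s A(2) c(1) B(2) c(2) rim[OF A(1)] rim[OF B(1)] v])
  moreover have "v \<in> verts G" using v s by (auto simp: splits_def)
  ultimately show "\<exists>v\<in>verts G. contractible_graph (del_point G v)" by blast
qed

text \<open>Both claims are needed in one induction: that rims of boundary points of \<open>D\<close> become spheres in
  \<open>D # C\<close> uses gluing of punctured spheres one dimension below.\<close>

lemma digital_sphere_induction:
  "(\<forall>G :: 'a::infinite graph. digital_sphere n G \<longrightarrow> verts G \<noteq> {} \<and>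
      (\<forall>v\<in>verts G. contractible_graph (del_point G v)) \<and>
      (\<forall>m. n = Suc m \<longrightarrow> closed_manifold_over (digital_sphere m) G)) \<and>
    glue_closed (digital_sphere n :: 'a graph \<Rightarrow> bool)"
proof (induction n)
  case 0
  have "contractible_graph (del_point G v)" if G: "zero_sphere G" and v: "v \<in> verts G" for G :: "'a graph" and v
  proof -
    obtain a b where ab: "a \<noteq> b" "G = Graph {a, b} {}" using G by (auto simp: zero_sphere_def)
    have "digital_space G" using digital_sphere_digital_space[of 0 G] G by simp
    then show ?thesis
      using ab v by (intro contractible_singleton[of _ "if v = a then b else a"]) auto
  qed
  moreover have "verts G \<noteq> {}" if "zero_sphere G" for G :: "'a graph" using that by (auto simp: zero_sphere_def)
  ultimately show ?case using glue_closed_zero_sphere by simp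
next
  case (Suc n)
  note IH = Suc.IH
  have glue: "glue_closed (digital_sphere n :: 'a graph \<Rightarrow> bool)" using IH by blast
  have S: "contractible_graph (del_point T v)" if "digital_sphere n T" "v \<in> verts T" for T :: "'a graph" and v
    using IH that by blast
  have ne: "verts T \<noteq> {}" if "digital_sphere n T" for T :: "'a graph" using IH that by blast
  have *: "closed_manifold_over (digital_sphere n) G \<and> (\<exists>v\<in>verts G. contractible_graph (del_point G v))"
    if G: "digital_sphere (Suc n) G" for G :: "'a graph"
  proof (cases n)
    case 0
    then have "one_sphere G" using G by simp
    then show ?thesis using 0 one_sphere_contractible_del_point[of G] one_sphere_iff[of G] by simp
  next
    case (Suc m)
    then show ?thesis
      using digital_sphere_Suc_Suc_closed[of m G] S ne glue G by blast
  qed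
  have closed: "closed_manifold_over (digital_sphere n) G" if "digital_sphere (Suc n) G" for G :: "'a graph"
    using *[OF that] by simp
  \<comment> \<open>One suitable point is enough: the rims are spheres of dimension
    \<open>n\<close>, contractible after any puncture, so every other point is suitable as
    well.\<close>
  have del: "contractible_graph (del_point G v)" if "digital_sphere (Suc n) G" "v \<in> verts G" for G :: "'a graph" and v
    using *[OF that(1)] closed_manifold_del_point_all[OF _ S] that(2) by blast
  have "verts G \<noteq> {}" if "digital_sphere (Suc n) G" for G :: "'a graph" using *[OF that] by blast
  moreover have "glue_closed (digital_sphere (Suc n) :: 'a graph \<Rightarrow> bool)"
    unfolding glue_closed_def
  proof (intro allI impI)
    fix G A B :: "'a graph" and U W a f b g
    assume s: "splits G U W" and AB: "digital_sphere (Suc n) A" "digital_sphere (Suc n) B"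
      and p: "punctured A a f G U (U \<inter> W)" "punctured B b g G W (U \<inter> W)"
    have aA: "a \<in> verts A" "b \<in> verts B" and UW: "U \<inter> W = f ` nbrs A a" using p by (auto simp: punctured_def)
    \<comment> \<open>Punctured spheres of dimension \<open>Suc n\<close> are contractible by the
      part just proved, so both pieces are contractible.\<close>
    have c: "contractible_graph (induced G U)" "contractible_graph (induced G W)"
      using punctured_contractible[OF p(1) del[OF AB(1) aA(1)]]
        punctured_contractible[OF p(2) del[OF AB(2) aA(2)]] by simp_all
    show "digital_sphere (Suc n) G"
    proof (cases n)
      case 0
      \<comment> \<open>For circles the union is checked directly: it is a closed manifold over
        0-spheres, and it is covered by two finite pieces.\<close>
      have "digital_sphere n (rim A a)" using closed[OF AB(1)] aA by (simp add: closed_manifold_over_def)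
      then have "U \<inter> W \<noteq> {}" using ne UW by fastforce
      then have "closed_manifold_over (digital_sphere n) G"
        using closed_manifold_glue[OF iso_closed_digital_sphere glue s closed[OF AB(1)] p(1) _ closed[OF AB(2)] p(2)]
          contractible_connected(1) c by blast
      moreover have "finite (verts G \<inter> U)" "finite (verts G \<inter> W)"
        using c contractible_digital_finite(1) by fastforce+
      then have "finite (verts G)" using s by (simp add: splits_def Int_absorb1)
      ultimately show ?thesis using 0 by (simp add: one_sphere_iff)
    next
      case (Suc m)
      \<comment> \<open>From dimension two on the pieces are disks with a common boundary, so their
        union is a sphere by definition.\<close>
      then show ?thesis
        using digital_sphere_Suc_SucI[OF s _ p(1) _ p(2) c] closed[OF AB(1)] closed[OF AB(2)] by blast
    qed
  qed
  ultimately show ?case using closed del by blast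
qed

lemma digital_sphere_contractible_del_point:
  fixes G :: "'a::infinite graph"
  shows "digital_sphere n G \<Longrightarrow> v \<in> verts G \<Longrightarrow> contractible_graph (del_point G v)"
  using digital_sphere_induction by blast

lemma digital_sphere_nonempty:
  fixes G :: "'a::infinite graph"
  shows "digital_sphere n G \<Longrightarrow> verts G \<noteq> {}"
  using digital_sphere_induction by blast

lemma digital_sphere_Suc_closed_manifold:
  fixes G :: "'a::infinite graph"
  shows "digital_sphere (Suc n) G \<Longrightarrow> closed_manifold_over (digital_sphere n) G"
  using digital_sphere_induction by blast

lemma finite_if_contractible_del_point:
  "contractible_graph (del_point G v) \<Longrightarrow> finite (verts G)"
  using contractible_digital_finite(1)[of "del_point G v"] by simp

lemma digital_sphere_finite:
  fixes G :: "'a::infinite graph"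
  assumes "digital_sphere n G" shows "finite (verts G)"
proof -
  obtain v where "v \<in> verts G" using digital_sphere_nonempty[OF assms] by auto
  then show ?thesis
    by (rule digital_sphere_contractible_del_point[OF assms, THEN finite_if_contractible_del_point])
qed

section \<open>Suspensions\<close>

text \<open>\<open>G\<close> is the suspension of its subspace on \<open>X\<close> with poles
  \<open>p\<close> and \<open>q\<close>. The poles are not adjacent: \<open>q\<close> lies outside
  its own neighbourhood, which is also that of \<open>p\<close>.\<close>

definition suspends :: "'a graph \<Rightarrow> 'a set \<Rightarrow> 'a \<Rightarrow> 'a \<Rightarrow> bool" where
  "suspends G X p q \<longleftrightarrow> digital_space G \<and> verts G = insert p (insert q X) \<and> p \<noteq> q
     \<and> nbrs G p = X \<and> nbrs G q = X"

lemma suspends_sym: "suspends G X p q \<Longrightarrow> suspends G X q p"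
  by (auto simp: suspends_def)

lemma suspends_notin: "suspends G X p q \<Longrightarrow> p \<notin> X \<and> q \<notin> X"
  unfolding suspends_def by (metis digital_spaceD(4) mem_nbrs)

text \<open>Removing one pole leaves the cone over \<open>X\<close> from the other pole, with
  \<open>X\<close> as boundary.\<close>

lemma suspends_punctured:
  assumes "suspends G X p q" shows "punctured G q id G (insert p X) X"
proof -
  have d: "digital_space G" and V: "verts G = insert p (insert q X)" and "p \<noteq> q" "nbrs G q = X"
    using assms by (auto simp: suspends_def)
  moreover have "del_point G q = induced G (insert p X)"
    unfolding del_point_def using suspends_notin[OF assms] \<open>p \<noteq> q\<close> V by (intro induced_cong[OF d]) auto
  ultimately show ?thesis by (auto simp: punctured_def)
qed

lemma suspends_splits:
  assumes "suspends G X p q" shows "splits G (insert p X) (insert q X)"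
proof -
  have d: "digital_space G" and V: "verts G = insert p (insert q X)" and pq: "p \<noteq> q" "nbrs G p = X" "nbrs G q = X"
    using assms by (auto simp: suspends_def)
  have n: "y \<in> X" if "(p, y) \<in> edges G \<or> (q, y) \<in> edges G" for y
    using that pq(2,3) by (metis mem_nbrs)
  have "edges G \<subseteq> insert p X \<times> insert p X \<union> insert q X \<times> insert q X"
  proof (rule subrelI)
    fix x y assume e: "(x, y) \<in> edges G"
    then show "(x, y) \<in> insert p X \<times> insert p X \<union> insert q X \<times> insert q X"
      using digital_spaceD[OF d e] n[of x] n[of y] V by auto
  qed
  then show ?thesis using d V by (auto simp: splits_def)
qed

lemma suspends_cone_contractible:
  assumes "suspends G X p q" "finite X" shows "contractible_graph (induced G (insert p X))"
proof (rule contractible_cone[where p = p])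
  show "digital_space (induced G (insert p X))" using assms by (simp add: suspends_def)
  show "finite (verts (induced G (insert p X)))" using assms by auto
  show "p \<in> verts (induced G (insert p X))" using assms by (auto simp: suspends_def)
  fix x assume "x \<in> verts (induced G (insert p X))" "x \<noteq> p"
  then have "x \<in> X" "x \<in> nbrs G p" using assms by (auto simp: suspends_def)
  then show "(p, x) \<in> edges (induced G (insert p X))" by simp
qed

text \<open>Both poles are adjacent to \<open>x\<close>, so they also suspend the rim of
  \<open>x\<close> in the base. This is the descent in the induction on the dimension.\<close>

lemma suspends_rim:
  assumes "suspends G X p q" "x \<in> X" shows "suspends (rim G x) (X \<inter> nbrs G x) p q"
proof -
  have d: "digital_space G" and V: "verts G = insert p (insert q X)" and pq: "p \<noteq> q" "nbrs G p = X" "nbrs G q = X"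
    using assms by (auto simp: suspends_def)
  have "(p, x) \<in> edges G" "(q, x) \<in> edges G" using pq assms(2) by auto
  then have "(x, p) \<in> edges G" "(x, q) \<in> edges G" using digital_spaceD(3)[OF d] by auto
  then show ?thesis using d V pq by (auto simp: suspends_def rim_def)
qed

text \<open>The rim of each pole is the base, so only base points need a separate hypothesis; a
  nonempty base connects the poles.\<close>

lemma suspends_closed_manifold:
  assumes s: "suspends G X p q" and S: "S (induced G X)" and X: "X \<noteq> {}"
    and rim: "\<And>x. x \<in> X \<Longrightarrow> S (rim G x)"
  shows "closed_manifold_over S G"
proof -
  have d: "digital_space G" and V: "verts G = insert p (insert q X)" and pq: "nbrs G p = X" "nbrs G q = X"
    using s by (auto simp: suspends_def)
  have "connected_graph G"
  proof (rule connected_graphI[OF d, where c = p])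
    obtain y where y: "y \<in> X" using X by auto
    have py: "(p, y) \<in> edges G" "(y, q) \<in> edges G"
      using y pq digital_spaceD(3)[OF d, of q y] mem_nbrs[of y G p] mem_nbrs[of y G q] by simp_all
    fix x assume "x \<in> verts G"
    then consider "x = p" | "x = q" | "x \<in> X" using V by auto
    then show "(p, x) \<in> (edges G)\<^sup>*"
    proof cases
      case 2
      then show ?thesis using py by (meson r_into_rtrancl rtrancl.rtrancl_into_rtrancl)
    next
      case 3
      then have "(p, x) \<in> edges G" unfolding pq(1)[symmetric] by simp
      then show ?thesis by simp
    qed simp
  qed (use V in simp)
  moreover have "S (rim G x)" if x: "x \<in> verts G" for x
  proof -
    consider "x = p" | "x = q" | "x \<in> X" using x V by auto
    then show ?thesis
    proof cases
      case 3
      then show ?thesis by (rule rim)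
    qed (use S in \<open>simp_all add: rim_def pq\<close>)
  qed
  ultimately show ?thesis using d by (simp add: closed_manifold_over_def)
qed

text \<open>By induction on \<open>m\<close>, the rim of a base point is the suspension of a smaller
  sphere and hence a sphere, so \<open>G\<close> is a closed manifold. It is the union of two cones,
  each of which is a disk.\<close>

lemma suspends_digital_sphere:
  fixes G :: "'a::infinite graph"
  assumes "suspends G X p q" "digital_sphere m (induced G X)"
  shows "closed_manifold_over (digital_sphere m) G" and "digital_sphere (Suc m) G"
proof -
  have *: "closed_manifold_over (digital_sphere m) G \<and> digital_sphere (Suc m) G"
    using assms
  proof (induction m arbitrary: G X)
    case (0 G X)
    note s = 0(1) and S = 0(2)
    have d: "digital_space G" and V: "verts G = insert p (insert q X)" and pq: "p \<noteq> q"
      using s by (auto simp: suspends_def)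
    obtain a b where ab: "induced G X = Graph {a, b} {}" using S by (auto simp: zero_sphere_def)
    have "verts (induced G X) = X" using V by auto
    then have X: "X = {a, b}" using ab by simp
    have e: "edges G \<inter> X \<times> X = {}" using arg_cong[OF ab, of edges] by simp
    \<comment> \<open>The two base points are not adjacent, so the rim of each consists of the poles
      alone; \<open>G\<close> is a circle of four points.\<close>
    have "digital_sphere 0 (rim G x)" if x: "x \<in> X" for x
    proof -
      have r: "suspends (rim G x) (X \<inter> nbrs G x) p q" by (rule suspends_rim[OF s x])
      have "X \<inter> nbrs G x = {}" using e x by auto
      then have r': "verts (rim G x) = {p, q}" "nbrs (rim G x) p = {}" "nbrs (rim G x) q = {}"
        "digital_space (rim G x)"
        using r by (auto simp: suspends_def)
      have "edges (rim G x) = {}"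
      proof -
        have "(y, z) \<notin> edges (rim G x)" for y z
        proof
          assume e: "(y, z) \<in> edges (rim G x)"
          then have "y = p \<or> y = q" using digital_spaceD(1)[OF r'(4)] r'(1) by blast
          then show False using e r'(2,3) by (metis empty_iff mem_nbrs)
        qed
        then show ?thesis by auto
      qed
      then have "rim G x = Graph {p, q} {}" using r'(1) by (metis graph.collapse)
      then show ?thesis using pq by (auto simp: zero_sphere_def)
    qed
    then have "closed_manifold_over (digital_sphere 0) G"
      using suspends_closed_manifold[where S = "digital_sphere 0", OF s S] X by simp
    then show ?case using X V by (simp add: one_sphere_iff)
  next
    case (Suc m G X)
    note s = Suc.prems(1) and S = Suc.prems(2)
    have XV: "X \<subseteq> verts G" "digital_space G" using s by (auto simp: suspends_def)
    have M: "closed_manifold_over (digital_sphere m) (induced G X)"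
      using S by (rule digital_sphere_Suc_closed_manifold)
    have ne: "X \<noteq> {}" and fin: "finite X"
      using digital_sphere_nonempty[OF S] digital_sphere_finite[OF S] XV by (auto simp: Int_absorb1)
    have "digital_sphere (Suc m) (rim G x)" if x: "x \<in> X" for x
    proof -
      have "digital_sphere m (rim (induced G X) x)" using M x XV by (auto simp: closed_manifold_over_def)
      moreover have "rim (induced G X) x = induced (rim G x) (X \<inter> nbrs G x)"
        using x by (simp add: rim_induced) (simp add: rim_def Int_ac)
      ultimately show ?thesis using Suc.IH[OF suspends_rim[OF s x]] by simp
    qed
    then have G: "closed_manifold_over (digital_sphere (Suc m)) G"
      using suspends_closed_manifold[where S = "digital_sphere (Suc m)", OF s S ne] by blast
    \<comment> \<open>Each cone is \<open>G\<close> minus the opposite pole, so \<open>G\<close>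
      itself serves as the closed manifold behind both disks.\<close>
    have "insert p X \<inter> insert q X = X" using suspends_notin[OF s] s by (auto simp: suspends_def)
    then have "digital_sphere (Suc (Suc m)) G"
      using digital_sphere_Suc_SucI[OF suspends_splits[OF s] G _ G]
        suspends_punctured[OF s] suspends_punctured[OF suspends_sym[OF s]]
        suspends_cone_contractible[OF s fin] suspends_cone_contractible[OF suspends_sym[OF s] fin]
      by metis
    then show ?case using G by blast
  qed
  show "closed_manifold_over (digital_sphere m) G" "digital_sphere (Suc m) G" using * by auto
qed

section \<open>From a contractible complement to a sphere\<close>

text \<open>The complement of \<open>v\<close> is a disk by hypothesis. For the other half, the star
  of \<open>v\<close>, a closed manifold has to be supplied of which the star is a puncture.\<close>

lemma digital_sphere_if_contractible_del_point:
  fixes M :: "'a::infinite graph"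
  assumes M: "closed_manifold_over (digital_sphere (Suc n)) M" and v: "v \<in> verts M"
    and c: "contractible_graph (del_point M v)"
  shows "digital_sphere (Suc (Suc n)) M"
proof -
  have d: "digital_space M" using M by (simp add: closed_manifold_over_def)
  have "finite (verts M)" using c by (rule finite_if_contractible_del_point)
  then obtain w where w: "w \<notin> verts M" using ex_new_if_finite[OF infinite_UNIV] by blast
  define N where "N = nbrs M v"
  have NV: "N \<subseteq> verts M" and vN: "v \<notin> N"
    using digital_spaceD(2)[OF d, of v] digital_spaceD(4)[OF d, of v v] by (auto simp: N_def)
  then have fin: "finite N" using \<open>finite (verts M)\<close> finite_subset by blast
  have eN: "y \<in> N" if "(v, y) \<in> edges M \<or> (y, v) \<in> edges M" for y
    using that digital_spaceD(3)[OF d] by (auto simp: N_def)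
  have ew: "(w, y) \<notin> edges M" "(y, w) \<notin> edges M" for y using w digital_spaceD(1,2)[OF d] by auto
  \<comment> \<open>The suspension of the rim of \<open>v\<close>, with \<open>v\<close> and the new
    point \<open>w\<close> as poles; without \<open>w\<close> it is the star of
    \<open>v\<close>.\<close>
  define H where "H = glue_point (induced M (insert v N)) w N"
  have VH: "verts H = insert w (insert v N)"
    and EH: "edges H = edges M \<inter> insert v N \<times> insert v N \<union> {w} \<times> N \<union> N \<times> {w}"
    using v NV by (auto simp: H_def glue_point_def)
  have dH: "digital_space H" unfolding H_def
    using d v w NV by (intro digital_space_glue_point) auto
  have wN: "w \<noteq> v" "w \<notin> N" using v w NV by auto
  have "(v, y) \<in> edges M \<longleftrightarrow> y \<in> N" for y by (simp add: N_def)
  then have "nbrs H v = N" "nbrs H w = N" using wN vN ew by (auto simp: EH)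
  then have s: "suspends H N v w" using dH VH wN by (auto simp: suspends_def)
  have HN: "induced H N = rim M v"
    unfolding rim_def N_def[symmetric] using NV wN vN by (auto simp: induced_def VH EH)
  have "digital_sphere (Suc n) (induced H N)"
    using M v HN by (simp add: closed_manifold_over_def)
  then have H: "closed_manifold_over (digital_sphere (Suc n)) H" using suspends_digital_sphere(1)[OF s] by blast
  have HM: "induced H (insert v N) = induced M (insert v N)"
    using NV wN v by (auto simp: induced_def VH EH)
  let ?U = "verts M - {v}" and ?W = "insert v N"
  have UW: "?U \<inter> ?W = N" using NV vN by auto
  have "edges M \<subseteq> ?U \<times> ?U \<union> ?W \<times> ?W"
  proof (rule subrelI)
    fix x y assume e: "(x, y) \<in> edges M"
    then show "(x, y) \<in> ?U \<times> ?U \<union> ?W \<times> ?W"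
      using digital_spaceD(1,2)[OF d e] eN[of x] eN[of y] by auto
  qed
  then have sM: "splits M ?U ?W" using d v NV by (auto simp: splits_def)
  have pM: "punctured M v id M ?U (?U \<inter> ?W)"
    unfolding UW using d v by (auto simp: punctured_def del_point_def N_def)
  have "punctured H w id H ?W N" by (rule suspends_punctured[OF s])
  \<comment> \<open>\<open>M\<close> and \<open>H\<close> agree on the star of \<open>v\<close>, so
    \<open>H\<close> punctured at \<open>w\<close> is found inside \<open>M\<close> too.\<close>
  then have pH: "punctured H w id M ?W (?U \<inter> ?W)"
    using d v NV unfolding UW punctured_def HM by blast
  have "contractible_graph (induced M ?U)" using c by (simp add: del_point_def)
  moreover have "contractible_graph (induced M ?W)"
    using suspends_cone_contractible[OF s fin] HM by simp
  ultimately show ?thesis by (rule digital_sphere_Suc_SucI[OF sM M pM H pH])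
qed

theorem corollary4p1:
  fixes M :: "'a::infinite graph" and n :: nat
  assumes "n \<ge> 1"
    and "closed_manifold n M"
  shows "digital_sphere n M \<longleftrightarrow> (\<exists>v\<in>verts M. contractible_graph (del_point M v))"
proof
  assume "digital_sphere n M"
  then show "\<exists>v\<in>verts M. contractible_graph (del_point M v)"
    using digital_sphere_nonempty digital_sphere_contractible_del_point by blast
next
  assume "\<exists>v\<in>verts M. contractible_graph (del_point M v)"
  then obtain v where v: "v \<in> verts M" "contractible_graph (del_point M v)" by blast
  consider "n = Suc 0" | m where "n = Suc (Suc m)" using assms(1) by (metis not0_implies_Suc not_one_le_zero)
  then show "digital_sphere n M"
  proof cases
    case 1
    \<comment> \<open>A closed 1-manifold may be infinite; here finiteness follows because
      \<open>M - v\<close> reduces to a point.\<close>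
    then show ?thesis
      using assms(2) finite_if_contractible_del_point[OF v(2)] by (simp add: closed_manifold_def one_sphere_iff)
  next
    case 2
    then show ?thesis
      using assms(2) digital_sphere_if_contractible_del_point[OF _ v] by (simp add: closed_manifold_def)
  qed
qed

end
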